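(* Let $S_n\ne 0$ be the sample covariance matrix of a sample in $\mathbb{R}^q$, and let $\eta\ge 0$, with $\eta>0$ if $S_n$ is singular. Let $\Pi_R(\Sigma)=\|\log\Sigma\|_F^2$ for $\Sigma>0$. Then the function $$L(\Sigma;S_n,\eta)=\mathrm{tr}(\Sigma^{-1}S_n)+\log\det\Sigma+\eta\,\Pi_R(\Sigma),\qquad \Sigma>0,$$ is strictly g-convex and g-coercive; consequently it has a unique critical point, and this critical point is its unique global minimizer over $\Sigma>0$.
   Context: $\Sigma>0$ means $\Sigma$ is a real symmetric positive definite matrix of order $q$; $\|\cdot\|_F$ is the Frobenius norm and $\log\Sigma$ the matrix logarithm. For a sample $x_1,\ldots,x_n\in\mathbb{R}^q$, the sample covariance matrix is $S_n=n^{-1}\sum_{i=1}^n(x_i-\bar x)(x_i-\bar x)^{\mathrm T}$. The geodesic path from $\Sigma_0>0$ to $\Sigma_1>0$ is $\Sigma_t=\Sigma_0^{1/2}\{\Sigma_0^{-1/2}\Sigma_1\Sigma_0^{-1/2}\}^t\Sigma_0^{1/2}$, $0\le t\le 1$. A function $F$ on $\Sigma>0$ is strictly g-convex if $F(\Sigma_t)<(1-t)F(\Sigma_0)+tF(\Sigma_1)$ for all $\Sigma_0\ne\Sigma_1$ and $0<t<1$. It is g-coercive if $F(\Sigma)\to\infty$ as $\|\log\Sigma\|_F\to\infty$. A critical point is a point at which the gradient vanishes ($L$ is differentiable here). *)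

theory Defs
  imports "HOL-Analysis.Analysis"
begin

definition sample_mean :: "nat \<Rightarrow> (nat \<Rightarrow> real^'q) \<Rightarrow> real^'q" where
  "sample_mean n x = (1 / real n) *\<^sub>R (\<Sum>i=1..n. x i)"

definition outer_prod :: "real^'q \<Rightarrow> real^'q \<Rightarrow> real^'q^'q" where
  "outer_prod u v = (columnvector u :: real^1^'q) ** (rowvector v :: real^'q^1)"

definition sample_cov :: "nat \<Rightarrow> (nat \<Rightarrow> real^'q) \<Rightarrow> real^'q^'q" where
  "sample_cov n x =
     (1 / real n) *\<^sub>R
       (\<Sum>i=1..n. outer_prod (x i - sample_mean n x) (x i - sample_mean n x))"

definition pos_def :: "real^'q^'q \<Rightarrow> bool" where
  "pos_def A \<longleftrightarrow> transpose A = A \<and> (\<forall>v. v \<noteq> 0 \<longrightarrow> 0 < v \<bullet> (A *v v))"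

definition diag_mat :: "real^'q \<Rightarrow> real^'q^'q" where
  "diag_mat d = (\<chi> i j. if i = j then d $ i else 0)"

text \<open>
  Functions of a real symmetric matrix: if \<open>A = U diag(d) U\<^sup>T\<close> with \<open>U\<close> orthogonal, then
  \<open>f(A) = U diag(f(d)) U\<^sup>T\<close>. The value does not depend on the chosen decomposition
  (\<open>mat_fun_diag\<close> below); for a matrix that is not symmetric it is unspecified.
\<close>

definition mat_fun :: "(real \<Rightarrow> real) \<Rightarrow> real^'q^'q \<Rightarrow> real^'q^'q" where
  "mat_fun f A = (THE B. \<exists>U d. orthogonal_matrix U \<and>
       A = U ** diag_mat d ** transpose U \<and>
       B = U ** diag_mat (\<chi> i. f (d $ i)) ** transpose U)"

definition mat_log :: "real^'q^'q \<Rightarrow> real^'q^'q" where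
  "mat_log A = mat_fun ln A"

definition mat_powr :: "real^'q^'q \<Rightarrow> real \<Rightarrow> real^'q^'q" where
  "mat_powr A t = mat_fun (\<lambda>r. r powr t) A"

definition geodesic :: "real^'q^'q \<Rightarrow> real^'q^'q \<Rightarrow> real \<Rightarrow> real^'q^'q" where
  "geodesic A B t =
     mat_powr A (1/2) **
     mat_powr (mat_powr A (- 1/2) ** B ** mat_powr A (- 1/2)) t **
     mat_powr A (1/2)"

definition strictly_g_convex :: "(real^'q^'q \<Rightarrow> real) \<Rightarrow> bool" where
  "strictly_g_convex F \<longleftrightarrow>
     (\<forall>A B t. pos_def A \<longrightarrow> pos_def B \<longrightarrow> A \<noteq> B \<longrightarrow> 0 < t \<longrightarrow> t < 1 \<longrightarrow>
        F (geodesic A B t) < (1 - t) * F A + t * F B)"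

text \<open>
  The Frobenius norm is \<open>norm\<close> on \<open>real^'q^'q\<close> (\<open>norm_matrix_frobenius\<close> below).
\<close>

definition g_coercive :: "(real^'q^'q \<Rightarrow> real) \<Rightarrow> bool" where
  "g_coercive F \<longleftrightarrow>
     filterlim F at_top
       (inf (filtercomap (\<lambda>A. norm (mat_log A)) at_top) (principal {A. pos_def A}))"

text \<open>
  The positive definite matrices form an open subset of the space of symmetric matrices, but
  not of \<open>real^'q^'q\<close>; hence the derivative is taken within that set and the gradient
  is required to be symmetric, which makes it unique.
\<close>

definition has_pd_gradient ::
    "(real^'q^'q \<Rightarrow> real) \<Rightarrow> real^'q^'q \<Rightarrow> real^'q^'q \<Rightarrow> bool" where
  "has_pd_gradient F G A \<longleftrightarrow>
     transpose G = G \<and> (F has_derivative (\<lambda>H. G \<bullet> H)) (at A within {A. pos_def A})"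

definition critical_point :: "(real^'q^'q \<Rightarrow> real) \<Rightarrow> real^'q^'q \<Rightarrow> bool" where
  "critical_point F A \<longleftrightarrow> pos_def A \<and> has_pd_gradient F 0 A"

definition riem_penalty :: "real^'q^'q \<Rightarrow> real" where
  "riem_penalty A = (norm (mat_log A))\<^sup>2"

definition penalized_loss :: "real^'q^'q \<Rightarrow> real \<Rightarrow> real^'q^'q \<Rightarrow> real" where
  "penalized_loss S \<eta> A = trace (matrix_inv A ** S) + ln (det A) + \<eta> * riem_penalty A"


lemma norm_matrix_frobenius:
  fixes A :: "real^'q^'q"
  shows "norm A = sqrt (\<Sum>i\<in>UNIV. \<Sum>j\<in>UNIV. (A $ i $ j)\<^sup>2)"
  by (simp add: norm_vec_def L2_set_def sum_nonneg)

lemma diag_mat_mult_right: "(A ** diag_mat d) $ i $ j = A $ i $ j * d $ j"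
  by (simp add: matrix_matrix_mult_def diag_mat_def if_distrib cong: if_cong)

lemma diag_mat_mult_left: "(diag_mat d ** A) $ i $ j = d $ i * A $ i $ j"
  by (simp add: matrix_matrix_mult_def diag_mat_def if_distrib [of "\<lambda>r. r * _"] cong: if_cong)

lemma mat_fun_diag:
  fixes U :: "real^'q^'q"
  assumes U: "orthogonal_matrix U" and A: "A = U ** diag_mat d ** transpose U"
  shows "mat_fun f A = U ** diag_mat (\<chi> i. f (d $ i)) ** transpose U"
  unfolding mat_fun_def
proof (rule the_equality)
  show "\<exists>U' d'. orthogonal_matrix U' \<and> A = U' ** diag_mat d' ** transpose U' \<and>
      U ** diag_mat (\<chi> i. f (d $ i)) ** transpose U =
      U' ** diag_mat (\<chi> i. f (d' $ i)) ** transpose U'"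
    using U A by blast
next
  fix B
  assume "\<exists>V e. orthogonal_matrix V \<and> A = V ** diag_mat e ** transpose V \<and>
      B = V ** diag_mat (\<chi> i. f (e $ i)) ** transpose V"
  then obtain V e where V: "orthogonal_matrix V" and AV: "A = V ** diag_mat e ** transpose V"
    and B: "B = V ** diag_mat (\<chi> i. f (e $ i)) ** transpose V" by blast
  have UU: "transpose U ** U = mat 1" "U ** transpose U = mat 1"
    and VV: "transpose V ** V = mat 1" "V ** transpose V = mat 1"
    using U V by (auto simp: orthogonal_matrix_def)
  define W where "W = transpose V ** U"
  have "W ** diag_mat d = transpose V ** A ** U"
    unfolding W_def A by (metis UU(1) matrix_mul_assoc matrix_mul_rid)
  also have "\<dots> = diag_mat e ** W"
    unfolding W_def AV by (metis VV(1) matrix_mul_assoc matrix_mul_lid)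
  finally have eq: "W $ i $ j * d $ j = e $ i * W $ i $ j" for i j
    by (metis diag_mat_mult_left diag_mat_mult_right)
  have "W $ i $ j * f (d $ j) = f (e $ i) * W $ i $ j" for i j
    using eq[of i j] by (cases "W $ i $ j = 0") auto
  then have feq: "W ** diag_mat (\<chi> i. f (d $ i)) = diag_mat (\<chi> i. f (e $ i)) ** W"
    by (simp add: vec_eq_iff diag_mat_mult_left diag_mat_mult_right)
  have VW: "V ** W = U" and WU: "W ** transpose U = transpose V"
    unfolding W_def by (metis VV(2) matrix_mul_assoc matrix_mul_lid,
        metis UU(2) matrix_mul_assoc matrix_mul_rid)
  have "U ** diag_mat (\<chi> i. f (d $ i)) ** transpose U
      = V ** (W ** diag_mat (\<chi> i. f (d $ i))) ** transpose U"
    by (simp add: VW matrix_mul_assoc)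
  also have "\<dots> = V ** diag_mat (\<chi> i. f (e $ i)) ** (W ** transpose U)"
    by (simp add: feq matrix_mul_assoc)
  also have "\<dots> = B"
    by (simp add: WU B)
  finally show "B = U ** diag_mat (\<chi> i. f (d $ i)) ** transpose U" ..
qed

lemma g_coercive_iff:
  "g_coercive F \<longleftrightarrow>
     (\<forall>M. \<exists>R. \<forall>A. pos_def A \<and> norm (mat_log A) \<ge> R \<longrightarrow> F A \<ge> M)"
  unfolding g_coercive_def filterlim_at_top eventually_inf_principal
    eventually_filtercomap_at_top_linorder
  by (simp add: imp_conjL) meson

end

theory Submission
  imports Defs "HOL-Real_Asymp.Real_Asymp"
begin

text \<open>
  Write \<open>exp_conj M d = M diag(exp d) M\<^sup>T\<close>. Two positive definite matrices \<open>A\<close> and \<open>B\<close> can be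
  diagonalized by one congruence, \<open>A = M M\<^sup>T\<close> and \<open>B = M diag(exp \<mu>) M\<^sup>T\<close> with \<open>M\<close> invertible, and then the
  geodesic between them is \<open>t \<mapsto> M diag(exp (t \<mu>)) M\<^sup>T\<close> (\<open>geodesic_eq_exp_conj\<close>). Along it \<open>log det\<close> is
  affine in \<open>t\<close>, and \<open>tr(\<Sigma>\<inverse> S)\<close> is a sum of terms \<open>q\<^sub>i exp (- t \<mu>\<^sub>i)\<close> with \<open>q\<^sub>i \<ge> 0\<close>, strictly convex when \<open>S\<close>
  is positive definite. What remains is that the penalty \<open>\<parallel>log \<Sigma>\<parallel>\<^sup>2\<close>, the squared geodesic distance from
  \<open>\<Sigma>\<close> to the identity, is strongly convex, which expresses the nonpositive curvature of the positive definite cone.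

  The curvature enters through one inequality: passing to logarithms does not increase distances
  (\<open>mat_log_diff_le_geodesic_length\<close>). Writing both sides in the eigenvalues \<open>p\<^sub>i\<close> of \<open>P\<close> and \<open>q\<^sub>j\<close> of \<open>Q\<close>,
  weighted by the squared entries of the orthogonal matrix that relates the two eigenbases, reduces the bound
  \<open>\<parallel>log P - log Q\<parallel>\<^sup>2 \<le> tr(P\<inverse> Q) + tr(P Q\<inverse>) - 2 n\<close>, with \<open>n\<close> the order of the matrices, to the scalar inequality \<open>x\<^sup>2 \<le> exp x + exp (- x) - 2\<close>.
  On a short piece of a geodesic the right-hand side is the squared length up to higher order terms, so adding up
  over ever finer subdivisions gives the claim, without differentiating the matrix logarithm.
  Strong convexity of the penalty (\<open>mat_log_norm_square_strongly_convex\<close>) then follows by moving the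
  point at parameter \<open>t\<close> to the identity and comparing with the corresponding equation in a Euclidean space.

  In spectral coordinates \<open>\<Sigma> = U diag(exp d) U\<^sup>T\<close> the loss is an explicit continuous function of
  \<open>(U, d)\<close> that exceeds \<open>\<parallel>d\<parallel>\<close> up to an additive constant. This gives coercivity (\<open>penalized_loss_lower_bound\<close>), and a minimizer
  exists because the orthogonal matrices form a compact set (\<open>penalized_loss_attains_min\<close>).
  Strict convexity makes the minimizer unique, and shows that every critical point is a minimizer.
  Conversely, at the minimizer only an upper bound of the loss by a quadratic polynomial is needed
  (\<open>penalized_loss_upper_expansion\<close>): minimality forces the linear term to vanish and supplies the
  matching lower bound, so the derivative exists there and is zero (\<open>minimum_imp_critical_point\<close>).
\<close>

section \<open>The spectral theorem for real symmetric matrices\<close>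

lemma inner_symmetric_matrix:
  fixes A :: "real^'n^'n"
  assumes "transpose A = A"
  shows "x \<bullet> (A *v y) = (A *v x) \<bullet> y"
  by (metis assms dot_lmul_matrix transpose_matrix_vector)

text \<open>
  A maximizer \<open>v\<close> of the quadratic form on the unit sphere of the subspace is an eigenvector: moving
  from \<open>v\<close> in the direction of the residual \<open>z = A v - c v\<close>, which stays in the subspace, would increase the
  quotient to first order by \<open>2 (z \<bullet> z)\<close>.
\<close>

lemma symmetric_invariant_subspace_eigenvector:
  fixes A :: "real^'n^'n"
  assumes sym: "transpose A = A" and W: "subspace W" and nz: "w0 \<in> W" "w0 \<noteq> 0"
    and inv: "\<And>w. w \<in> W \<Longrightarrow> A *v w \<in> W"
  obtains v c where "v \<in> W" "norm v = 1" "A *v v = c *\<^sub>R v"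
proof -
  define K where "K = W \<inter> sphere 0 1"
  have "compact K"
    unfolding K_def by (simp add: W closed_Int_compact closed_subspace)
  moreover have "w0 /\<^sub>R norm w0 \<in> K"
    unfolding K_def using nz W by (simp add: subspace_scale)
  moreover have "continuous_on K (\<lambda>v. v \<bullet> (A *v v))"
    by (intro continuous_intros)
  ultimately obtain v where v: "v \<in> K" and mx: "\<And>u. u \<in> K \<Longrightarrow> u \<bullet> (A *v u) \<le> v \<bullet> (A *v v)"
    using continuous_attains_sup[of K "\<lambda>v. v \<bullet> (A *v v)"] by (metis empty_iff)
  define c where "c = v \<bullet> (A *v v)"
  have vW: "v \<in> W" and vn: "norm v = 1"
    using v by (auto simp: K_def)
  have vv: "v \<bullet> v = 1"
    using vn by (simp add: norm_eq_1)
  have bound: "w \<bullet> (A *v w) \<le> c * (w \<bullet> w)" if w: "w \<in> W" for w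
  proof (cases "w = 0")
    case False
    define u where "u = w /\<^sub>R norm w"
    have u: "u \<in> K"
      unfolding u_def K_def using W w False by (simp add: subspace_scale)
    have "w = norm w *\<^sub>R u"
      using False by (simp add: u_def)
    then have "w \<bullet> (A *v w) = (norm w)\<^sup>2 * (u \<bullet> (A *v u))"
      by (metis inner_scaleR_left inner_scaleR_right matrix_vector_mult_scaleR mult.assoc power2_eq_square)
    also have "\<dots> \<le> (norm w)\<^sup>2 * c"
      using mx[OF u] by (simp add: c_def mult_left_mono)
    finally show ?thesis
      by (simp add: power2_norm_eq_inner mult.commute)
  qed simp
  define z where "z = A *v v - c *\<^sub>R v"
  have zW: "z \<in> W"
    unfolding z_def using W vW inv by (simp add: subspace_diff subspace_scale)
  define k where "k = c * (z \<bullet> z) - z \<bullet> (A *v z)"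
  have first_order: "2 * t * (z \<bullet> z) \<le> t\<^sup>2 * k" for t
  proof -
    have tw: "v + t *\<^sub>R z \<in> W"
      using W vW zW by (simp add: subspace_add subspace_scale)
    have sw: "v \<bullet> (A *v z) = z \<bullet> (A *v v)"
      by (metis inner_commute inner_symmetric_matrix sym)
    have zz: "z \<bullet> z = z \<bullet> (A *v v) - c * (z \<bullet> v)"
      by (subst (2) z_def) (simp add: inner_diff_right)
    have e1: "(v + t *\<^sub>R z) \<bullet> (A *v (v + t *\<^sub>R z))
        = c + 2 * t * (z \<bullet> (A *v v)) + t\<^sup>2 * (z \<bullet> (A *v z))"
      by (simp add: matrix_vector_right_distrib matrix_vector_mult_scaleR inner_add_left
          inner_add_right sw c_def power2_eq_square algebra_simps)
    have e2: "(v + t *\<^sub>R z) \<bullet> (v + t *\<^sub>R z) = 1 + 2 * t * (z \<bullet> v) + t\<^sup>2 * (z \<bullet> z)"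
      by (simp add: inner_add_left inner_add_right vv power2_eq_square inner_commute algebra_simps)
    have "z \<bullet> (A *v v) = z \<bullet> z + c * (z \<bullet> v)"
      using zz by simp
    from bound[OF tw, unfolded e1 e2, unfolded this] show ?thesis
      by (simp add: k_def algebra_simps)
  qed
  have "z \<bullet> z = 0"
  proof (rule ccontr)
    assume "z \<bullet> z \<noteq> 0"
    then have pos: "z \<bullet> z > 0"
      using inner_ge_zero[of z] by linarith
    then have k: "k > 0"
      using first_order[of 1] by (simp del: inner_gt_zero_iff)
    have "2 * ((z \<bullet> z) / k) * (z \<bullet> z) \<le> (z \<bullet> z) * (z \<bullet> z) / k"
      using first_order[of "(z \<bullet> z) / k"] k by (simp add: power2_eq_square)
    then show False
      using k mult_pos_pos[OF pos pos] by (simp add: field_simps)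
  qed
  then have "A *v v = c *\<^sub>R v"
    by (simp add: z_def)
  then show thesis
    using that vW vn by blast
qed

text \<open>
  An orthonormal set of eigenvectors of largest cardinality is a basis: its orthogonal complement is
  invariant, so it would otherwise contain one more eigenvector.
\<close>

theorem symmetric_diagonalization:
  fixes A :: "real^'n^'n"
  assumes sym: "transpose A = A"
  obtains U d where "orthogonal_matrix U" "A = U ** diag_mat d ** transpose U"
proof -
  define P where "P E \<longleftrightarrow> pairwise orthogonal E \<and> (\<forall>v\<in>E. norm v = 1 \<and> (\<exists>c. A *v v = c *\<^sub>R v))"
    for E :: "(real^'n) set"
  have indep: "independent E" if "P E" for E
    using that unfolding P_def
    by (intro pairwise_orthogonal_independent) auto
  have card_le: "card E \<le> CARD('n)" if "P E" for E
    using independent_bound[OF indep[OF that]] by simp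
  have "P {}"
    by (simp add: P_def)
  then obtain E where E: "P E" and mx: "\<And>F. P F \<Longrightarrow> card F \<le> card E"
    using ex_has_greatest_nat[of P "{}" card "CARD('n) + 1"] card_le by force
  have fin: "finite E"
    using indep[OF E] independent_bound by blast
  define W where "W = {w. \<forall>v\<in>E. w \<bullet> v = 0}"
  have eig: "\<exists>c. A *v v = c *\<^sub>R v" if "v \<in> E" for v
    using E that by (simp add: P_def)
  have W: "subspace W"
    by (auto simp: W_def subspace_def inner_add_left)
  have inv: "A *v w \<in> W" if "w \<in> W" for w
  proof -
    have "(A *v w) \<bullet> v = 0" if v: "v \<in> E" for v
    proof -
      obtain c where "A *v v = c *\<^sub>R v"
        using eig[OF v] by blast
      then show ?thesis
        using \<open>w \<in> W\<close> v inner_symmetric_matrix[OF sym, of w v] by (simp add: W_def)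
    qed
    then show ?thesis
      by (simp add: W_def)
  qed
  have W0: "w = 0" if w: "w \<in> W" for w
  proof (rule ccontr)
    assume "w \<noteq> 0"
    then obtain v c where v: "v \<in> W" "norm v = 1" "A *v v = c *\<^sub>R v"
      using symmetric_invariant_subspace_eigenvector[OF sym W w _ inv] by metis
    have "v \<notin> E"
      using v by (auto simp: W_def norm_eq_1)
    moreover have "P (insert v E)"
      using E v by (auto simp: P_def W_def pairwise_insert orthogonal_def inner_commute)
    ultimately show False
      using mx[of "insert v E"] fin by simp
  qed
  have span: "span E = UNIV"
  proof -
    have "y \<in> span E" for y
    proof -
      obtain a b where a: "a \<in> span E" and b: "\<forall>w\<in>span E. orthogonal b w" and y: "y = a + b"
        using orthogonal_subspace_decomp_exists[of E y] by (metis (lifting))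
      have "b = 0"
        using W0[of b] b span_base by (auto simp: W_def orthogonal_def)
      then show ?thesis
        using a y by simp
    qed
    then show ?thesis
      by auto
  qed
  have "card E = CARD('n)"
    using dim_eq_card_independent[OF indep[OF E]] dim_span[of E] unfolding span by simp
  then obtain f where f: "bij_betw f (UNIV :: 'n set) E"
    using finite_same_card_bij[OF finite fin] by metis
  define U :: "real^'n^'n" where "U = (\<chi> i j. f j $ i)"
  have colU: "column j U = f j" for j
    by (simp add: U_def column_def)
  have fE: "f j \<in> E" for j
    using f by (auto simp: bij_betw_def)
  have U: "orthogonal_matrix U"
    unfolding orthogonal_matrix_orthonormal_columns colU
  proof (intro conjI allI impI)
    show "norm (f i) = 1" for i
      using E fE by (auto simp: P_def)
    show "orthogonal (f i) (f j)" if "i \<noteq> j" for i j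
    proof -
      have "f i \<noteq> f j"
        using f that by (auto simp: bij_betw_def inj_on_def)
      then show ?thesis
        using E fE by (auto simp: P_def pairwise_def)
    qed
  qed
  have "\<forall>j. \<exists>c. A *v f j = c *\<^sub>R f j"
    using eig fE by simp
  then obtain d0 where d0: "\<And>j. A *v f j = d0 j *\<^sub>R f j"
    by metis
  define d :: "real^'n" where "d = (\<chi> j. d0 j)"
  have "(A ** U) $ i $ j = (U ** diag_mat d) $ i $ j" for i j
  proof -
    have "(A ** U) $ i $ j = (A *v f j) $ i"
      by (simp add: matrix_matrix_mult_def matrix_vector_mult_def U_def)
    also have "\<dots> = (U ** diag_mat d) $ i $ j"
      by (simp add: d0 diag_mat_mult_right U_def d_def)
    finally show ?thesis .
  qed
  then have "A ** U = U ** diag_mat d"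
    by (simp add: vec_eq_iff)
  then have "A = U ** diag_mat d ** transpose U"
    using U by (metis matrix_mul_assoc matrix_mul_rid orthogonal_matrix_def)
  with U show thesis
    using that by blast
qed

section \<open>Exponentials of diagonal matrices under congruence\<close>

lemma inner_matrix_eq_trace:
  fixes A B :: "real^'n^'m"
  shows "A \<bullet> B = trace (transpose A ** B)"
proof -
  have "A \<bullet> B = (\<Sum>i\<in>UNIV. \<Sum>j\<in>UNIV. A $ i $ j * B $ i $ j)"
    by (simp add: inner_vec_def)
  also have "\<dots> = (\<Sum>j\<in>UNIV. \<Sum>i\<in>UNIV. A $ i $ j * B $ i $ j)"
    by (rule sum.swap)
  finally show ?thesis
    by (simp add: trace_def matrix_matrix_mult_def transpose_def)
qed

lemma diag_mat_mult: "diag_mat d ** diag_mat e = diag_mat (\<chi> i. d $ i * e $ i)"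
  by (simp add: vec_eq_iff diag_mat_mult_left) (simp add: diag_mat_def)

lemma transpose_diag_mat [simp]: "transpose (diag_mat d) = diag_mat d"
  by (auto simp: vec_eq_iff diag_mat_def transpose_def)

lemma diag_mat_one: "diag_mat (\<chi> i. 1) = mat 1"
  by (simp add: vec_eq_iff diag_mat_def mat_def)

lemma det_diag_mat: "det (diag_mat d) = (\<Prod>i\<in>UNIV. d $ i)"
  by (subst det_diagonal) (auto simp: diag_mat_def)

lemma matrix_inv_unique:
  fixes A B :: "real^'n^'n"
  assumes "A ** B = mat 1"
  shows "matrix_inv A = B"
proof -
  have BA: "B ** A = mat 1"
    using assms matrix_left_right_inverse by blast
  have "invertible A"
    using assms BA by (auto simp: invertible_def)
  then have "matrix_inv A ** A = mat 1"
    by (metis (mono_tags, lifting) invertible_def matrix_inv_def someI_ex)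
  then show ?thesis
    by (metis assms matrix_mul_assoc matrix_mul_lid matrix_mul_rid)
qed

lemma invertible_mult_matrix_inv:
  fixes M :: "real^'n^'n"
  assumes "invertible M"
  shows "M ** matrix_inv M = mat 1" "matrix_inv M ** M = mat 1"
  using assms unfolding invertible_def matrix_inv_def
  by (metis (mono_tags, lifting) someI_ex)+

lemma orthogonal_matrix_invertible: "orthogonal_matrix U \<Longrightarrow> invertible U"
  by (auto simp: orthogonal_matrix_def invertible_def)

text \<open>
  For orthogonal \<open>M\<close> this is the spectral form of a positive definite matrix with logarithmic eigenvalues
  \<open>d\<close>; for invertible \<open>M\<close> and \<open>d = t \<mu>\<close> it runs through a geodesic. Storing the logarithms makes positivity automatic
  and turns geodesics into straight lines.
\<close>

definition exp_conj :: "real^'n^'n \<Rightarrow> real^'n \<Rightarrow> real^'n^'n" where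
  "exp_conj M d = M ** diag_mat (\<chi> i. exp (d $ i)) ** transpose M"

lemma transpose_exp_conj [simp]: "transpose (exp_conj M d) = exp_conj M d"
  by (simp add: exp_conj_def matrix_transpose_mul matrix_mul_assoc)

lemma exp_conj_0: "exp_conj M 0 = M ** transpose M"
  by (simp add: exp_conj_def diag_mat_one)

lemma exp_conj_mult_left: "exp_conj (P ** M) d = P ** exp_conj M d ** transpose P"
  by (simp add: exp_conj_def matrix_transpose_mul matrix_mul_assoc)

lemma inner_diag_conj:
  fixes M :: "real^'n^'n"
  shows "v \<bullet> ((M ** diag_mat d ** transpose M) *v v) = (\<Sum>i\<in>UNIV. d $ i * ((transpose M *v v) $ i)\<^sup>2)"
proof -
  have "v \<bullet> ((M ** diag_mat d ** transpose M) *v v) = (transpose M *v v) \<bullet> (diag_mat d *v (transpose M *v v))"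
    by (metis dot_lmul_matrix matrix_vector_mul_assoc transpose_matrix_vector)
  moreover have "(diag_mat d *v w) $ i = d $ i * w $ i" for w :: "real^'n" and i
    by (simp add: matrix_vector_mult_def diag_mat_def if_distrib [of "\<lambda>r. r * _"] cong: if_cong)
  ultimately show ?thesis
    by (simp add: inner_vec_def power2_eq_square algebra_simps del: transpose_matrix_vector)
qed

lemma pos_def_exp_conj:
  fixes M :: "real^'n^'n"
  assumes M: "invertible M"
  shows "pos_def (exp_conj M d)"
  unfolding pos_def_def
proof (intro conjI allI impI)
  show "transpose (exp_conj M d) = exp_conj M d"
    by simp
next
  fix v :: "real^'n"
  assume v: "v \<noteq> 0"
  define w where "w = transpose M *v v"
  have "w \<noteq> 0"
  proof
    assume "w = 0"
    have "transpose (matrix_inv M) ** transpose M = mat 1"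
      by (metis M invertible_mult_matrix_inv(1) matrix_transpose_mul transpose_mat)
    then have "v = transpose (matrix_inv M) *v w"
      unfolding w_def by (metis matrix_vector_mul_assoc matrix_vector_mul_lid)
    with v \<open>w = 0\<close> show False
      by (simp del: transpose_matrix_vector)
  qed
  then obtain i where "w $ i \<noteq> 0"
    by (auto simp: vec_eq_iff)
  then have "0 < (\<Sum>i\<in>UNIV. exp (d $ i) * (w $ i)\<^sup>2)"
    by (intro sum_pos2[of _ i]) auto
  then show "0 < v \<bullet> (exp_conj M d *v v)"
    by (simp add: exp_conj_def inner_diag_conj w_def del: transpose_matrix_vector)
qed

lemma pos_def_spectral:
  fixes A :: "real^'n^'n"
  assumes A: "pos_def A"
  obtains U d where "orthogonal_matrix U" "A = exp_conj U d"
proof -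
  obtain U e where U: "orthogonal_matrix U" and Ae: "A = U ** diag_mat e ** transpose U"
    using A symmetric_diagonalization unfolding pos_def_def by metis
  have e: "e $ i > 0" for i
  proof -
    have UU: "transpose U ** U = mat 1"
      using U by (simp add: orthogonal_matrix_def)
    define v where "v = U *v axis i 1"
    have Uv: "transpose U *v v = axis i 1"
      unfolding v_def by (metis UU matrix_vector_mul_assoc matrix_vector_mul_lid)
    have "v \<noteq> 0"
    proof
      assume "v = 0"
      with Uv have "axis i (1::real) = 0"
        by (simp del: transpose_matrix_vector) 
      then show False
        by (simp add: axis_eq_0_iff)
    qed
    then have "0 < v \<bullet> (A *v v)"
      using A by (simp add: pos_def_def)
    also have "\<dots> = (\<Sum>j\<in>UNIV. e $ j * (axis i 1 $ j)\<^sup>2)"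
      unfolding Ae inner_diag_conj Uv ..
    also have "\<dots> = e $ i"
      by (simp add: axis_def if_distrib[of "\<lambda>r. r\<^sup>2"] if_distrib[of "(*) _"] cong: if_cong)
    finally show ?thesis .
  qed
  have "A = exp_conj U (\<chi> i. ln (e $ i))"
    using e by (simp add: Ae exp_conj_def)
  with U that show thesis
    by blast
qed

lemma matrix_inv_exp_conj:
  fixes M :: "real^'n^'n"
  assumes "invertible M"
  shows "matrix_inv (exp_conj M d) = exp_conj (transpose (matrix_inv M)) (- d)"
proof (rule matrix_inv_unique)
  have 1: "transpose M ** transpose (matrix_inv M) = mat 1"
    by (metis assms invertible_mult_matrix_inv(2) matrix_transpose_mul transpose_mat)
  have 2: "diag_mat (\<chi> i. exp (d $ i)) ** diag_mat (\<chi> i. exp ((- d) $ i)) = mat 1"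
    by (simp add: diag_mat_mult exp_minus diag_mat_one)
  have "exp_conj M d ** exp_conj (transpose (matrix_inv M)) (- d)
     = M ** diag_mat (\<chi> i. exp (d $ i)) ** (transpose M ** transpose (matrix_inv M))
         ** diag_mat (\<chi> i. exp ((- d) $ i)) ** matrix_inv M"
    by (simp add: exp_conj_def matrix_mul_assoc)
  also have "\<dots> = M ** (diag_mat (\<chi> i. exp (d $ i)) ** diag_mat (\<chi> i. exp ((- d) $ i))) ** matrix_inv M"
    by (simp add: 1 matrix_mul_assoc)
  also have "\<dots> = mat 1"
    by (simp only: 2 matrix_mul_rid invertible_mult_matrix_inv[OF assms])
  finally show "exp_conj M d ** exp_conj (transpose (matrix_inv M)) (- d) = mat 1" .
qed

lemma orthogonal_matrix_inv: "orthogonal_matrix (U :: real^'n^'n) \<Longrightarrow> matrix_inv U = transpose U"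
  by (intro matrix_inv_unique) (simp add: orthogonal_matrix_def)

lemma matrix_inv_exp_conj_orthogonal:
  "orthogonal_matrix U \<Longrightarrow> matrix_inv (exp_conj U d) = exp_conj U (- d)"
  by (simp add: matrix_inv_exp_conj orthogonal_matrix_inv orthogonal_matrix_invertible)

lemma exp_conj_add:
  assumes "orthogonal_matrix U"
  shows "exp_conj U a ** exp_conj U b = exp_conj U (a + b)"
proof -
  have "exp_conj U a ** exp_conj U b
     = U ** diag_mat (\<chi> i. exp (a $ i)) ** (transpose U ** U)
         ** diag_mat (\<chi> i. exp (b $ i)) ** transpose U"
    by (simp add: exp_conj_def matrix_mul_assoc)
  also have "transpose U ** U = mat 1"
    using assms by (simp add: orthogonal_matrix_def)
  finally show ?thesis
    by (simp add: exp_conj_def exp_add diag_mat_mult matrix_mul_assoc[symmetric])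
qed

lemma ln_det_exp_conj:
  fixes M :: "real^'n^'n"
  assumes "invertible M"
  shows "ln (det (exp_conj M d)) = 2 * ln \<bar>det M\<bar> + (\<Sum>i\<in>UNIV. d $ i)"
proof -
  have "det M \<noteq> 0"
    using assms by (simp add: invertible_det_nz)
  moreover have "ln (b\<^sup>2 * exp s) = 2 * ln b + s" if "b > 0" for b s :: real
    using that by (simp add: ln_mult ln_realpow)
  moreover have "det (exp_conj M d) = \<bar>det M\<bar>\<^sup>2 * exp (\<Sum>i\<in>UNIV. d $ i)"
    by (simp add: exp_conj_def det_mul det_diag_mat exp_sum power2_eq_square)
  ultimately show ?thesis
    by (metis zero_less_abs_iff)
qed

lemma mat_log_exp_conj:
  assumes "orthogonal_matrix U"
  shows "mat_log (exp_conj U d) = U ** diag_mat d ** transpose U"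
  unfolding mat_log_def
  by (subst mat_fun_diag[OF assms exp_conj_def]) simp

lemma mat_powr_exp_conj:
  assumes "orthogonal_matrix U"
  shows "mat_powr (exp_conj U d) t = exp_conj U (t *\<^sub>R d)"
  unfolding mat_powr_def
  by (subst mat_fun_diag[OF assms exp_conj_def]) (simp add: exp_conj_def powr_def)

text \<open>
  With \<open>R = A\<^sup>1\<^sup>/\<^sup>2\<close> and the spectral decomposition \<open>R\<inverse> B R\<inverse> = V diag(exp \<mu>) V\<^sup>T\<close>, the matrix \<open>M = R V\<close> diagonalizes
  \<open>A\<close> and \<open>B\<close> simultaneously.
\<close>

lemma geodesic_eq_exp_conj:
  fixes A B :: "real^'n^'n"
  assumes A: "pos_def A" and B: "pos_def B"
  obtains M \<mu> where "invertible M" "A = exp_conj M 0" "B = exp_conj M \<mu>"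
    "\<And>t. geodesic A B t = exp_conj M (t *\<^sub>R \<mu>)"
proof -
  obtain U a where U: "orthogonal_matrix U" and Aa: "A = exp_conj U a"
    using pos_def_spectral[OF A] by blast
  define R where "R = mat_powr A (1/2)"
  define R' where "R' = mat_powr A (- 1/2)"
  have RR: "R ** R = A" "R ** R' = mat 1" "R' ** R = mat 1"
    unfolding R_def R'_def Aa mat_powr_exp_conj[OF U] exp_conj_add[OF U]
    using U by (simp_all add: exp_conj_0 orthogonal_matrix_def flip: scaleR_add_left)
  have tr: "transpose R = R" "transpose R' = R'"
    unfolding R_def R'_def Aa mat_powr_exp_conj[OF U] by simp_all
  have R: "invertible R" and R': "invertible R'"
    using RR by (auto simp: invertible_def)
  obtain W b where W: "orthogonal_matrix W" and Bb: "B = exp_conj W b"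
    using pos_def_spectral[OF B] by blast
  have "R' ** B ** R' = exp_conj (R' ** W) b"
    by (simp add: Bb exp_conj_mult_left tr)
  moreover have "invertible (R' ** W)"
    by (intro invertible_mult R' orthogonal_matrix_invertible W)
  ultimately have "pos_def (R' ** B ** R')"
    by (simp add: pos_def_exp_conj)
  then obtain V \<mu> where V: "orthogonal_matrix V" and C: "R' ** B ** R' = exp_conj V \<mu>"
    using pos_def_spectral by blast
  show thesis
  proof (rule that[of "R ** V" \<mu>])
    show "invertible (R ** V)"
      by (intro invertible_mult R orthogonal_matrix_invertible V)
    show "A = exp_conj (R ** V) 0"
      using V by (simp only: exp_conj_mult_left exp_conj_0[of V] tr RR orthogonal_matrix_def matrix_mul_rid)
    have "exp_conj (R ** V) \<mu> = (R ** R') ** B ** (R' ** R)"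
      by (simp add: exp_conj_mult_left tr matrix_mul_assoc flip: C)
    then show "B = exp_conj (R ** V) \<mu>"
      by (simp add: RR)
    show "geodesic A B t = exp_conj (R ** V) (t *\<^sub>R \<mu>)" for t
      unfolding geodesic_def R_def[symmetric] R'_def[symmetric] C mat_powr_exp_conj[OF V]
        exp_conj_mult_left tr ..
  qed
qed

section \<open>Logarithms contract distances\<close>

lemma norm_square_vec: "(norm (x :: real^'n))\<^sup>2 = (\<Sum>i\<in>UNIV. (x $ i)\<^sup>2)"
  by (simp add: norm_vec_def L2_set_def sum_nonneg)

text \<open>
  The squared entries of an orthogonal matrix are doubly stochastic. They serve as weights that couple the
  eigenvalues of two matrices with different eigenbases, and so reduce trace inequalities to scalar ones.
\<close>

lemma orthogonal_matrix_sum_squares: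
  fixes W :: "real^'n^'n"
  assumes W: "orthogonal_matrix W"
  shows "(\<Sum>j\<in>UNIV. (W $ i $ j)\<^sup>2) = 1" "(\<Sum>i\<in>UNIV. (W $ i $ j)\<^sup>2) = 1"
proof -
  have "(W ** transpose W) $ i $ i = 1" "(transpose W ** W) $ j $ j = 1"
    using W by (simp_all add: orthogonal_matrix_def mat_def)
  then show "(\<Sum>j\<in>UNIV. (W $ i $ j)\<^sup>2) = 1" "(\<Sum>i\<in>UNIV. (W $ i $ j)\<^sup>2) = 1"
    by (simp_all add: matrix_matrix_mult_def transpose_def power2_eq_square)
qed

lemma trace_diag_conj_mult:
  fixes U V :: "real^'n^'n"
  shows "trace ((U ** diag_mat a ** transpose U) ** (V ** diag_mat b ** transpose V))
       = (\<Sum>i\<in>UNIV. \<Sum>j\<in>UNIV. ((transpose U ** V) $ i $ j)\<^sup>2 * (a $ i * b $ j))"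
proof -
  define W where "W = transpose U ** V"
  have "trace ((U ** diag_mat a ** transpose U) ** (V ** diag_mat b ** transpose V))
      = trace (U ** (diag_mat a ** W ** diag_mat b ** transpose V))"
    by (simp add: W_def matrix_mul_assoc)
  also have "\<dots> = trace ((diag_mat a ** W ** diag_mat b) ** transpose W)"
    by (subst trace_mul_sym) (simp add: W_def matrix_transpose_mul matrix_mul_assoc)
  also have "\<dots> = (\<Sum>i\<in>UNIV. \<Sum>j\<in>UNIV. (W $ i $ j)\<^sup>2 * (a $ i * b $ j))"
  proof -
    have "(X ** transpose W) $ i $ i = (\<Sum>j\<in>UNIV. X $ i $ j * W $ i $ j)" for X :: "real^'n^'n" and i
      by (simp add: matrix_matrix_mult_def transpose_def)
    then show ?thesis
      unfolding trace_def
      by (simp add: diag_mat_mult_right diag_mat_mult_left power2_eq_square algebra_simps)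
  qed
  finally show ?thesis
    by (simp add: W_def)
qed

lemma norm_diag_conj_diff:
  fixes U V :: "real^'n^'n"
  assumes U: "orthogonal_matrix U" and V: "orthogonal_matrix V"
  shows "(norm (U ** diag_mat a ** transpose U - V ** diag_mat b ** transpose V))\<^sup>2
       = (\<Sum>i\<in>UNIV. \<Sum>j\<in>UNIV. ((transpose U ** V) $ i $ j)\<^sup>2 * (a $ i - b $ j)\<^sup>2)"
proof -
  define W where "W = transpose U ** V"
  have W: "orthogonal_matrix W"
    unfolding W_def using U V by (simp add: orthogonal_matrix_mul)
  define P where "P = U ** diag_mat a ** transpose U"
  define Q where "Q = V ** diag_mat b ** transpose V"
  have sym: "transpose P = P" "transpose Q = Q"
    by (simp_all add: P_def Q_def matrix_transpose_mul matrix_mul_assoc)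
  have conj_sq: "(Z ** diag_mat e ** transpose Z) \<bullet> (Z ** diag_mat e ** transpose Z) = (\<Sum>i\<in>UNIV. (e $ i)\<^sup>2)"
    if "orthogonal_matrix Z" for Z :: "real^'n^'n" and e
  proof -
    have "transpose Z ** Z = mat 1"
      using that by (simp add: orthogonal_matrix_def)
    then show ?thesis
      by (simp add: inner_matrix_eq_trace matrix_transpose_mul trace_diag_conj_mult[unfolded matrix_mul_assoc] matrix_mul_assoc)
         (simp add: mat_def power2_eq_square if_distrib[of "\<lambda>r. r * _"] cong: if_cong)
  qed
  have "(norm (P - Q))\<^sup>2 = P \<bullet> P + Q \<bullet> Q - 2 * (P \<bullet> Q)"
    by (simp add: power2_norm_eq_inner inner_diff_left inner_diff_right inner_commute)
  also have "P \<bullet> P = (\<Sum>i\<in>UNIV. \<Sum>j\<in>UNIV. (W $ i $ j)\<^sup>2 * (a $ i)\<^sup>2)"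
    using conj_sq[OF U] orthogonal_matrix_sum_squares(1)[OF W]
    by (simp add: P_def flip: sum_distrib_right)
  also have "Q \<bullet> Q = (\<Sum>i\<in>UNIV. \<Sum>j\<in>UNIV. (W $ i $ j)\<^sup>2 * (b $ j)\<^sup>2)"
    using conj_sq[OF V] orthogonal_matrix_sum_squares(2)[OF W]
    by (subst sum.swap) (simp add: Q_def flip: sum_distrib_right)
  also have "P \<bullet> Q = (\<Sum>i\<in>UNIV. \<Sum>j\<in>UNIV. (W $ i $ j)\<^sup>2 * (a $ i * b $ j))"
    by (simp add: inner_matrix_eq_trace sym) (simp add: P_def Q_def W_def trace_diag_conj_mult)
  finally show ?thesis
    by (simp add: P_def Q_def flip: W_def)
       (simp add: power2_diff algebra_simps sum.distrib sum_subtractf sum_distrib_left)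
qed

lemma norm_mat_log_exp_conj:
  fixes U :: "real^'n^'n"
  assumes "orthogonal_matrix U"
  shows "norm (mat_log (exp_conj U d)) = norm d"
proof -
  have W: "transpose U ** U = mat 1"
    using assms by (simp add: orthogonal_matrix_def)
  have "diag_mat (0 :: real^'n) = 0"
    by (simp add: vec_eq_iff diag_mat_def)
  then have "(norm (mat_log (exp_conj U d)))\<^sup>2 = (norm d)\<^sup>2"
    using norm_diag_conj_diff[OF assms assms, of d 0]
    by (simp add: mat_log_exp_conj[OF assms] W power2_norm_eq_inner[of d] inner_vec_def
        flip: power2_eq_square)
       (simp add: mat_def if_distrib[of "\<lambda>r. r\<^sup>2"] if_distrib[of "\<lambda>r. r * _"] cong: if_cong)
  then show ?thesis
    by simp
qed

text \<open>
  The right-hand side is \<open>(2 sinh (x / 2))\<^sup>2\<close>.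
\<close>

lemma square_le_exp_sum:
  fixes x :: real
  shows "x\<^sup>2 \<le> exp x + exp (- x) - 2"
proof -
  have "\<bar>x\<bar> \<le> \<bar>2 * sinh (x / 2)\<bar>"
    using real_le_abs_sinh[of "x / 2"] by (simp add: sinh_field_def exp_minus)
  then have "x\<^sup>2 \<le> (2 * sinh (x / 2))\<^sup>2"
    by (simp add: abs_le_square_iff)
  also have "\<dots> = exp x + exp (- x) - 2"
  proof -
    have "exp x = (exp (x / 2))\<^sup>2" "exp (- x) = (exp (- (x / 2)))\<^sup>2" "exp (x/2) * exp (-(x/2)) = 1"
      by (simp_all flip: exp_double exp_add)
    moreover have "2 * sinh (x / 2) = exp (x / 2) - exp (- (x / 2))"
      by (simp add: sinh_field_def)
    ultimately show ?thesis
      by (simp add: power2_diff)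
  qed
  finally show ?thesis .
qed

lemma mat_log_diff_le_trace:
  fixes P Q :: "real^'n^'n"
  assumes P: "pos_def P" and Q: "pos_def Q"
  shows "(norm (mat_log P - mat_log Q))\<^sup>2
       \<le> trace (matrix_inv P ** Q) + trace (P ** matrix_inv Q) - 2 * real CARD('n)"
proof -
  obtain U p where U: "orthogonal_matrix U" and Pp: "P = exp_conj U p"
    using pos_def_spectral[OF P] by blast
  obtain V q where V: "orthogonal_matrix V" and Qq: "Q = exp_conj V q"
    using pos_def_spectral[OF Q] by blast
  define W where "W = transpose U ** V"
  have W: "orthogonal_matrix W"
    unfolding W_def using U V by (simp add: orthogonal_matrix_mul)
  have "(norm (mat_log P - mat_log Q))\<^sup>2
      = (\<Sum>i\<in>UNIV. \<Sum>j\<in>UNIV. (W $ i $ j)\<^sup>2 * (p $ i - q $ j)\<^sup>2)"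
    unfolding Pp Qq mat_log_exp_conj[OF U] mat_log_exp_conj[OF V] W_def
    by (rule norm_diag_conj_diff[OF U V])
  also have "\<dots> \<le> (\<Sum>i\<in>UNIV. \<Sum>j\<in>UNIV. (W $ i $ j)\<^sup>2 * (exp (p $ i - q $ j) + exp (- (p $ i - q $ j)) - 2))"
    by (intro sum_mono mult_left_mono square_le_exp_sum) simp
  also have "\<dots> = (\<Sum>i\<in>UNIV. \<Sum>j\<in>UNIV. (W $ i $ j)\<^sup>2 * (exp (- p $ i) * exp (q $ j)))
      + (\<Sum>i\<in>UNIV. \<Sum>j\<in>UNIV. (W $ i $ j)\<^sup>2 * (exp (p $ i) * exp (- q $ j)))
      - 2 * (\<Sum>i\<in>UNIV. \<Sum>j\<in>UNIV. (W $ i $ j)\<^sup>2)"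
    by (simp add: algebra_simps sum.distrib sum_subtractf sum_distrib_left flip: exp_add)
  also have "(\<Sum>i\<in>UNIV. \<Sum>j\<in>UNIV. (W $ i $ j)\<^sup>2) = CARD('n)"
    by (simp add: orthogonal_matrix_sum_squares[OF W])
  also have "(\<Sum>i\<in>UNIV. \<Sum>j\<in>UNIV. (W $ i $ j)\<^sup>2 * (exp (- p $ i) * exp (q $ j))) = trace (matrix_inv P ** Q)"
    unfolding Pp Qq matrix_inv_exp_conj_orthogonal[OF U]
    unfolding exp_conj_def trace_diag_conj_mult W_def
    by simp
  also have "(\<Sum>i\<in>UNIV. \<Sum>j\<in>UNIV. (W $ i $ j)\<^sup>2 * (exp (p $ i) * exp (- q $ j))) = trace (P ** matrix_inv Q)"
    unfolding Pp Qq matrix_inv_exp_conj_orthogonal[OF V]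
    unfolding exp_conj_def trace_diag_conj_mult W_def
    by simp
  finally show ?thesis .
qed

text \<open>
  As a function of \<open>a\<close> this is a combination of exponentials whose coefficients are the diagonal entries of a
  matrix congruent to \<open>S\<close>, hence nonnegative when \<open>S\<close> is positive semidefinite.
\<close>

lemma trace_matrix_inv_exp_conj:
  fixes M :: "real^'n^'n"
  assumes M: "invertible M"
  shows "trace (matrix_inv (exp_conj M a) ** S)
       = (\<Sum>i\<in>UNIV. exp (- a $ i) * (matrix_inv M ** S ** transpose (matrix_inv M)) $ i $ i)"
proof -
  define N where "N = matrix_inv M"
  have "trace (matrix_inv (exp_conj M a) ** S) = trace (transpose N ** (diag_mat (\<chi> i. exp ((- a) $ i)) ** N ** S))"
    unfolding matrix_inv_exp_conj[OF M]
    unfolding exp_conj_def N_def by (simp add: matrix_mul_assoc)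
  also have "\<dots> = trace (diag_mat (\<chi> i. exp ((- a) $ i)) ** (N ** S ** transpose N))"
    by (subst trace_mul_sym) (simp add: matrix_mul_assoc)
  also have "\<dots> = (\<Sum>i\<in>UNIV. exp (- a $ i) * (N ** S ** transpose N) $ i $ i)"
    by (simp add: trace_def diag_mat_mult_left)
  finally show ?thesis
    by (simp add: N_def)
qed

lemma trace_inv_exp_conj_mult:
  fixes M :: "real^'n^'n"
  assumes M: "invertible M"
  shows "trace (matrix_inv (exp_conj M a) ** exp_conj M b) = (\<Sum>i\<in>UNIV. exp (b $ i - a $ i))"
proof -
  have "matrix_inv M ** exp_conj M b ** transpose (matrix_inv M) = exp_conj (matrix_inv M ** M) b"
    by (simp only: exp_conj_mult_left)
  also have "\<dots> = diag_mat (\<chi> i. exp (b $ i))"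
    by (simp add: invertible_mult_matrix_inv[OF M] exp_conj_def)
  finally show ?thesis
    by (simp add: trace_matrix_inv_exp_conj[OF M] exp_diff exp_minus diag_mat_def field_simps)
qed

text \<open>
  The distance between two points of the geodesic at parameters \<open>s\<close> and \<open>t\<close> satisfies, after taking
  logarithms, a bound that agrees with \<open>\<parallel>(s - t) \<mu>\<parallel>\<^sup>2\<close> up to fourth order. Cutting \<open>[0, 1]\<close> into \<open>N\<close> equal pieces and letting
  \<open>N\<close> tend to infinity removes the error.
\<close>

theorem mat_log_diff_le_geodesic_length:
  fixes M :: "real^'n^'n"
  assumes M: "invertible M"
  shows "norm (mat_log (exp_conj M \<mu>) - mat_log (exp_conj M 0)) \<le> norm \<mu>"
proof -
  define L where "L = (\<lambda>t. mat_log (exp_conj M (t *\<^sub>R \<mu>)))"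
  have step: "(norm (L s - L t))\<^sup>2 \<le> (\<Sum>i\<in>UNIV. exp ((s - t) * \<mu> $ i) + exp (- ((s - t) * \<mu> $ i)) - 2)" for s t
  proof -
    have "(norm (L s - L t))\<^sup>2 \<le> (\<Sum>i\<in>UNIV. exp (t * \<mu> $ i - s * \<mu> $ i))
        + (\<Sum>i\<in>UNIV. exp (s * \<mu> $ i - t * \<mu> $ i)) - 2 * real CARD('n)"
      using mat_log_diff_le_trace[OF pos_def_exp_conj pos_def_exp_conj, OF M M, of "s *\<^sub>R \<mu>" "t *\<^sub>R \<mu>"]
      unfolding L_def by (subst (asm) (2) trace_mul_sym) (simp add: trace_inv_exp_conj_mult[OF M])
    then show ?thesis
      by (simp add: sum.distrib sum_subtractf algebra_simps)
  qed
  define g where "g = (\<lambda>N. \<Sum>i\<in>UNIV. (real N)\<^sup>2 * (exp (\<mu> $ i / real N) + exp (- (\<mu> $ i / real N)) - 2))"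
  have bound: "(norm (L 1 - L 0))\<^sup>2 \<le> g N" if N: "N > 0" for N
  proof -
    have "L 1 - L 0 = (\<Sum>k<N. L (real (Suc k) / N) - L (real k / N))"
      using N by (subst sum_lessThan_telescope) simp
    then have "norm (L 1 - L 0) \<le> (\<Sum>k<N. norm (L (real (Suc k) / N) - L (real k / N)))"
      by (simp add: norm_sum)
    also have "\<dots> \<le> (\<Sum>k<N. sqrt (\<Sum>i\<in>UNIV. exp (\<mu> $ i / real N) + exp (- (\<mu> $ i / real N)) - 2))"
    proof (intro sum_mono real_le_rsqrt)
      fix k
      have "(real (Suc k) / N - real k / N) * x = x / N" for x
        using N by (simp add: field_simps)
      then show "(norm (L (real (Suc k) / N) - L (real k / N)))\<^sup>2
          \<le> (\<Sum>i\<in>UNIV. exp (\<mu> $ i / real N) + exp (- (\<mu> $ i / real N)) - 2)"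
        using step[of "real (Suc k) / N" "real k / N"] by simp
    qed
    finally have "norm (L 1 - L 0) \<le> N * sqrt (\<Sum>i\<in>UNIV. exp (\<mu> $ i / real N) + exp (- (\<mu> $ i / real N)) - 2)"
      by simp
    then have "(norm (L 1 - L 0))\<^sup>2 \<le> (N * sqrt (\<Sum>i\<in>UNIV. exp (\<mu> $ i / real N) + exp (- (\<mu> $ i / real N)) - 2))\<^sup>2"
      by (rule power_mono) simp
    also have "\<dots> = g N"
    proof -
      have "(\<Sum>i\<in>UNIV. exp (\<mu> $ i / real N) + exp (- (\<mu> $ i / real N)) - 2) \<ge> 0"
        by (intro sum_nonneg order_trans[OF _ square_le_exp_sum]) simp
      then show ?thesis
        by (simp add: power_mult_distrib g_def sum_distrib_left)
    qed
    finally show ?thesis .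
  qed
  have "(\<lambda>N. (real N)\<^sup>2 * (exp (x / real N) + exp (- (x / real N)) - 2)) \<longlonglongrightarrow> x\<^sup>2" for x :: real
    unfolding power2_eq_square[of x] by real_asymp
  then have "g \<longlonglongrightarrow> (\<Sum>i\<in>UNIV. (\<mu> $ i)\<^sup>2)"
    unfolding g_def by (intro tendsto_sum) 
  moreover have "eventually (\<lambda>N. (norm (L 1 - L 0))\<^sup>2 \<le> g N) sequentially"
    using bound by (auto simp: eventually_at_top_dense)
  ultimately have "(norm (L 1 - L 0))\<^sup>2 \<le> (\<Sum>i\<in>UNIV. (\<mu> $ i)\<^sup>2)"
    by (intro tendsto_lowerbound) auto
  also have "\<dots> = (norm \<mu>)\<^sup>2"
    by (simp add: norm_square_vec)
  finally show ?thesis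
    unfolding L_def by simp
qed

section \<open>Strict convexity along geodesics\<close>

text \<open>
  Any point of a geodesic can serve as its origin.
\<close>

lemma exp_conj_shift:
  fixes M :: "real^'n^'n"
  shows "exp_conj (M ** diag_mat (\<chi> i. exp (a $ i / 2))) b = exp_conj M (a + b)"
proof -
  have "diag_mat (\<chi> i. exp (a $ i / 2)) ** diag_mat (\<chi> i. exp (b $ i)) ** diag_mat (\<chi> i. exp (a $ i / 2))
      = diag_mat (\<chi> i. exp ((a + b) $ i))"
    by (simp add: diag_mat_mult flip: exp_add)
  moreover have "exp_conj (M ** X) b = M ** (X ** diag_mat (\<chi> i. exp (b $ i)) ** transpose X) ** transpose M" for X
    by (simp add: exp_conj_def matrix_transpose_mul matrix_mul_assoc)
  ultimately show ?thesis
    by (simp add: exp_conj_def)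
qed

lemma invertible_mult_exp_diag:
  fixes M :: "real^'n^'n"
  assumes "invertible M"
  shows "invertible (M ** diag_mat (\<chi> i. exp (a $ i)))"
  using assms by (simp add: invertible_det_nz det_mul det_diag_mat)

lemma diag_mat_scaleR: "diag_mat (c *\<^sub>R d) = c *\<^sub>R diag_mat d"
  by (simp add: vec_eq_iff diag_mat_def)

lemma norm_diag_mat: "norm (diag_mat d) = norm d"
  using norm_mat_log_exp_conj[OF orthogonal_matrix_id, of d] mat_log_exp_conj[OF orthogonal_matrix_id, of d]
  by simp

text \<open>
  The congruence by the inverse of \<open>N\<close> preserves geodesic distances. It sends \<open>exp_conj N \<nu>\<close> to \<open>diag(exp \<nu>)\<close> and
  the identity to the inverse of \<open>N\<^sup>T N\<close>, and \<open>\<parallel>log A\<parallel>\<close> is the distance from \<open>A\<close> to the identity; so this is the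
  contraction property of the logarithm for the image points.
\<close>

lemma mat_log_comparison:
  fixes N :: "real^'n^'n"
  assumes N: "invertible N"
  shows "norm (diag_mat \<nu> - mat_log (exp_conj (matrix_inv N) 0)) \<le> norm (mat_log (exp_conj N \<nu>))"
proof -
  define A where "A = exp_conj N \<nu>"
  have inv: "invertible (matrix_inv N)"
    using invertible_mult_matrix_inv[OF N] by (auto simp: invertible_def)
  obtain W \<alpha> where W: "orthogonal_matrix W" and A: "A = exp_conj W \<alpha>"
    using pos_def_spectral pos_def_exp_conj[OF N] unfolding A_def by metis
  have "exp_conj (matrix_inv N ** W) \<alpha> = exp_conj (matrix_inv N ** N) \<nu>"
    by (simp only: exp_conj_mult_left flip: A A_def)
  then have 1: "exp_conj (matrix_inv N ** W) \<alpha> = exp_conj (mat 1) \<nu>"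
    by (simp add: invertible_mult_matrix_inv[OF N])
  have 0: "exp_conj (matrix_inv N ** W) 0 = exp_conj (matrix_inv N) 0"
    using W by (simp add: exp_conj_mult_left exp_conj_0[of W] exp_conj_0[of "matrix_inv N"] orthogonal_matrix_def)
  have "norm (mat_log (exp_conj (mat 1) \<nu>) - mat_log (exp_conj (matrix_inv N) 0)) \<le> norm \<alpha>"
    using mat_log_diff_le_geodesic_length[of "matrix_inv N ** W" \<alpha>] W inv
    unfolding 0 1 by (simp add: invertible_mult orthogonal_matrix_invertible)
  also have "norm \<alpha> = norm (mat_log A)"
    by (simp add: A norm_mat_log_exp_conj[OF W])
  finally show ?thesis
    by (simp add: A_def mat_log_exp_conj[OF orthogonal_matrix_id])
qed

text \<open>
  The two sides are in fact equal, since \<open>N N\<^sup>T\<close> and the inverse of \<open>N\<^sup>T N\<close> have reciprocal eigenvalues; the stated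
  inequality is the preceding comparison for the inverse of \<open>N\<close> and \<open>\<nu> = 0\<close>.
\<close>

lemma norm_mat_log_inverse_gram:
  fixes N :: "real^'n^'n"
  assumes N: "invertible N"
  shows "norm (mat_log (exp_conj N 0)) \<le> norm (mat_log (exp_conj (matrix_inv N) 0))"
proof -
  have inv: "invertible (matrix_inv N)"
    using invertible_mult_matrix_inv[OF N] by (auto simp: invertible_def)
  moreover have "matrix_inv (matrix_inv N) = N"
    by (simp add: matrix_inv_unique invertible_mult_matrix_inv[OF N])
  moreover have "diag_mat (0 :: real^'n) = 0"
    using diag_mat_scaleR[of 0 "0 :: real^'n"] by simp
  ultimately show ?thesis
    using mat_log_comparison[of "matrix_inv N" 0] by simp
qed

text \<open>
  Take the point at parameter \<open>t\<close> as \<open>N N\<^sup>T\<close>, so that the end points have exponents \<open>- t \<mu>\<close> and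
  \<open>(1 - t) \<mu>\<close>. The three logarithmic norms compare with the lengths of \<open>Y\<close>, \<open>Y + t D\<close> and \<open>Y - (1 - t) D\<close> in
  the Euclidean space of matrices, where \<open>D = diag \<mu>\<close>, and there the inequality is the identity
  \<open>(1 - t) \<parallel>Y + t D\<parallel>\<^sup>2 + t \<parallel>Y - (1 - t) D\<parallel>\<^sup>2 = \<parallel>Y\<parallel>\<^sup>2 + t (1 - t) \<parallel>D\<parallel>\<^sup>2\<close>.
\<close>

theorem mat_log_norm_square_strongly_convex:
  fixes M :: "real^'n^'n"
  assumes M: "invertible M" and t: "0 \<le> t" "t \<le> 1"
  shows "(norm (mat_log (exp_conj M (t *\<^sub>R \<mu>))))\<^sup>2 + t * (1 - t) * (norm \<mu>)\<^sup>2
       \<le> (1 - t) * (norm (mat_log (exp_conj M 0)))\<^sup>2 + t * (norm (mat_log (exp_conj M \<mu>)))\<^sup>2"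
proof -
  define N where "N = M ** diag_mat (\<chi> i. exp ((t *\<^sub>R \<mu>) $ i / 2))"
  have N: "invertible N"
    unfolding N_def using invertible_mult_exp_diag[OF M, of "(t / 2) *\<^sub>R \<mu>"] by (simp add: field_simps)
  have shift: "exp_conj N b = exp_conj M (t *\<^sub>R \<mu> + b)" for b
    unfolding N_def by (rule exp_conj_shift)
  define Y where "Y = mat_log (exp_conj (matrix_inv N) 0)"
  define D where "D = diag_mat \<mu>"
  have "norm ((- t) *\<^sub>R D - Y) \<le> norm (mat_log (exp_conj M 0))"
    using mat_log_comparison[OF N, of "(- t) *\<^sub>R \<mu>"]
    unfolding shift diag_mat_scaleR Y_def D_def by simp
  then have 0: "(norm ((- t) *\<^sub>R D - Y))\<^sup>2 \<le> (norm (mat_log (exp_conj M 0)))\<^sup>2"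
    by (rule power_mono) simp
  have "norm ((1 - t) *\<^sub>R D - Y) \<le> norm (mat_log (exp_conj M \<mu>))"
    using mat_log_comparison[OF N, of "(1 - t) *\<^sub>R \<mu>"]
    unfolding shift diag_mat_scaleR Y_def D_def by (simp flip: scaleR_add_left)
  then have 1: "(norm ((1 - t) *\<^sub>R D - Y))\<^sup>2 \<le> (norm (mat_log (exp_conj M \<mu>)))\<^sup>2"
    by (rule power_mono) simp
  have "norm (mat_log (exp_conj M (t *\<^sub>R \<mu>))) \<le> norm Y"
    using norm_mat_log_inverse_gram[OF N] unfolding shift Y_def by simp
  then have "(norm (mat_log (exp_conj M (t *\<^sub>R \<mu>))))\<^sup>2 \<le> (norm Y)\<^sup>2"
    by (rule power_mono) simp
  moreover have "t * (1 - t) * (norm \<mu>)\<^sup>2 = t * (1 - t) * (norm D)\<^sup>2"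
    by (simp add: D_def norm_diag_mat)
  moreover have "(norm Y)\<^sup>2 + t * (1 - t) * (norm D)\<^sup>2
      = (1 - t) * (norm ((- t) *\<^sub>R D - Y))\<^sup>2 + t * (norm ((1 - t) *\<^sub>R D - Y))\<^sup>2"
    unfolding power2_norm_eq_inner
    by (simp add: inner_diff_left inner_diff_right inner_commute) (simp add: algebra_simps)
  moreover have "(1 - t) * (norm ((- t) *\<^sub>R D - Y))\<^sup>2 \<le> (1 - t) * (norm (mat_log (exp_conj M 0)))\<^sup>2"
    using t by (intro mult_left_mono[OF 0]) simp
  moreover have "t * (norm ((1 - t) *\<^sub>R D - Y))\<^sup>2 \<le> t * (norm (mat_log (exp_conj M \<mu>)))\<^sup>2"
    using t by (intro mult_left_mono[OF 1])
  ultimately show ?thesis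
    by linarith
qed

lemma one_plus_less_exp:
  fixes x :: real
  assumes "x \<noteq> 0"
  shows "1 + x < exp x"
proof (cases "1 + x / 2 \<ge> 0")
  case True
  have "1 + x < (1 + x / 2)\<^sup>2"
    using zero_less_power2[of x] assms by (simp add: power2_eq_square algebra_simps)
  also have "\<dots> \<le> (exp (x / 2))\<^sup>2"
    using True by (intro power_mono exp_ge_add_one_self)
  finally show ?thesis
    by (simp flip: exp_double)
next
  case False
  then show ?thesis
    using exp_gt_zero[of x] by linarith
qed

text \<open>
  Add the tangent line inequalities at \<open>t x\<close> towards \<open>0\<close> and towards \<open>x\<close>.
\<close>

lemma exp_strictly_convex:
  fixes x t :: real
  assumes "x \<noteq> 0" "0 < t" "t < 1"
  shows "exp (t * x) < (1 - t) + t * exp x"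
proof -
  have "(1 - t) * (1 + (- t * x)) < (1 - t) * exp (- t * x)"
    using assms by (intro mult_strict_left_mono one_plus_less_exp) auto
  moreover have "t * (1 + (1 - t) * x) < t * exp ((1 - t) * x)"
    using assms by (intro mult_strict_left_mono one_plus_less_exp) auto
  ultimately have "1 < (1 - t) * exp (- t * x) + t * exp ((1 - t) * x)"
    by (simp add: algebra_simps)
  then have "exp (t * x) * 1 < exp (t * x) * ((1 - t) * exp (- t * x) + t * exp ((1 - t) * x))"
    by (intro mult_strict_left_mono) auto
  also have "\<dots> = (1 - t) * (exp (t * x) * exp (- t * x)) + t * (exp (t * x) * exp ((1 - t) * x))"
    by (simp add: algebra_simps)
  also have "\<dots> = (1 - t) + t * exp x"
    by (simp add: algebra_simps flip: exp_add)
  finally show ?thesis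
    by simp
qed

lemma diag_entry_congruence:
  fixes N S :: "real^'n^'n"
  shows "(N ** S ** transpose N) $ i $ i = row i N \<bullet> (S *v row i N)"
proof -
  have "row i N = transpose N *v axis i 1"
    by (simp add: vec_eq_iff matrix_vector_mult_basis column_def row_def transpose_def del: transpose_matrix_vector)
  moreover have "(N ** S ** transpose N) $ i $ i = axis i 1 \<bullet> ((N ** S ** transpose N) *v axis i 1)"
    by (simp add: inner_axis' matrix_vector_mult_basis column_def)
  ultimately show ?thesis
    by (metis dot_lmul_matrix matrix_vector_mul_assoc transpose_matrix_vector)
qed

lemma penalized_loss_exp_conj:
  fixes M :: "real^'n^'n"
  assumes M: "invertible M"
  shows "penalized_loss S \<eta> (exp_conj M a)
       = (\<Sum>i\<in>UNIV. exp (- a $ i) * (row i (matrix_inv M) \<bullet> (S *v row i (matrix_inv M))))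
         + (2 * ln \<bar>det M\<bar> + (\<Sum>i\<in>UNIV. a $ i)) + \<eta> * (norm (mat_log (exp_conj M a)))\<^sup>2"
  by (simp add: penalized_loss_def riem_penalty_def trace_matrix_inv_exp_conj[OF M]
      ln_det_exp_conj[OF M] diag_entry_congruence)

theorem penalized_loss_strictly_g_convex:
  fixes S :: "real^'n^'n"
  assumes psd: "\<And>v. 0 \<le> v \<bullet> (S *v v)" and \<eta>: "\<eta> \<ge> 0" and strict: "pos_def S \<or> \<eta> > 0"
  shows "strictly_g_convex (penalized_loss S \<eta>)"
  unfolding strictly_g_convex_def
proof (intro allI impI)
  fix A B :: "real^'n^'n" and t :: real
  assume A: "pos_def A" and B: "pos_def B" and neq: "A \<noteq> B" and t: "0 < t" "t < 1"
  obtain M \<mu> where M: "invertible M" and AM: "A = exp_conj M 0" and BM: "B = exp_conj M \<mu>"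
    and G: "\<And>t. geodesic A B t = exp_conj M (t *\<^sub>R \<mu>)"
    using geodesic_eq_exp_conj[OF A B] by metis
  have "\<mu> \<noteq> 0"
    using neq AM BM by auto
  define q where "q = (\<lambda>i. row i (matrix_inv M) \<bullet> (S *v row i (matrix_inv M)))"
  have q: "q i \<ge> 0" for i
    unfolding q_def by (rule psd)
  define T where "T = (\<lambda>a :: real^'n. \<Sum>i\<in>UNIV. exp (- a $ i) * q i)"
  define R where "R = (\<lambda>a. (norm (mat_log (exp_conj M a)))\<^sup>2)"
  have F: "penalized_loss S \<eta> (exp_conj M a) = T a + (2 * ln \<bar>det M\<bar> + (\<Sum>i\<in>UNIV. a $ i)) + \<eta> * R a" for a
    unfolding penalized_loss_exp_conj[OF M] T_def q_def R_def ..
  have termwise: "exp (- (t * \<mu> $ i)) * q i \<le> (1 - t) * q i + t * (exp (- \<mu> $ i) * q i)" for i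
  proof -
    have "exp (t * (- \<mu> $ i)) \<le> (1 - t) + t * exp (- \<mu> $ i)"
      using exp_strictly_convex[of "- \<mu> $ i" t] t by (cases "\<mu> $ i = 0") auto
    from mult_right_mono[OF this q[of i]] show ?thesis
      by (simp add: algebra_simps)
  qed
  have T: "(1 - t) * T 0 + t * T \<mu> = (\<Sum>i\<in>UNIV. (1 - t) * q i + t * (exp (- \<mu> $ i) * q i))"
    by (simp add: T_def sum.distrib sum_distrib_left)
  have T_le: "T (t *\<^sub>R \<mu>) \<le> (1 - t) * T 0 + t * T \<mu>"
    unfolding T unfolding T_def by (intro sum_mono) (use termwise in simp)
  have R_less: "R (t *\<^sub>R \<mu>) < (1 - t) * R 0 + t * R \<mu>"
  proof -
    have "0 < t * (1 - t) * (norm \<mu>)\<^sup>2"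
      using t \<open>\<mu> \<noteq> 0\<close> by simp
    then show ?thesis
      using mat_log_norm_square_strongly_convex[OF M, of t \<mu>] t unfolding R_def by linarith
  qed
  have "T (t *\<^sub>R \<mu>) + \<eta> * R (t *\<^sub>R \<mu>) < ((1 - t) * T 0 + t * T \<mu>) + \<eta> * ((1 - t) * R 0 + t * R \<mu>)"
  proof (cases "\<eta> > 0")
    case True
    then show ?thesis
      using T_le R_less by (intro add_le_less_mono) auto
  next
    case False
    then have S: "pos_def S"
      using strict by simp
    obtain k where k: "\<mu> $ k \<noteq> 0"
      using \<open>\<mu> \<noteq> 0\<close> by (auto simp: vec_eq_iff)
    have "row k (matrix_inv M) \<noteq> 0"
    proof
      assume 0: "row k (matrix_inv M) = 0"
      have "(matrix_inv M ** M) $ k $ k = row k (matrix_inv M) \<bullet> column k M"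
        by (simp add: matrix_matrix_mult_def row_def column_def inner_vec_def)
      with 0 show False
        by (simp add: invertible_mult_matrix_inv[OF M] mat_def)
    qed
    then have "q k > 0"
      using S by (simp add: q_def pos_def_def)
    have "exp (t * (- \<mu> $ k)) < (1 - t) + t * exp (- \<mu> $ k)"
      using exp_strictly_convex[of "- \<mu> $ k" t] t k by simp
    from mult_strict_right_mono[OF this \<open>q k > 0\<close>]
    have "exp (- (t * \<mu> $ k)) * q k < (1 - t) * q k + t * (exp (- \<mu> $ k) * q k)"
      by (simp add: algebra_simps)
    then have "T (t *\<^sub>R \<mu>) < (1 - t) * T 0 + t * T \<mu>"
      unfolding T unfolding T_def using termwise by (intro sum_strict_mono_ex1) auto
    then show ?thesis
      using R_less \<eta> by (intro add_less_le_mono mult_left_mono) auto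
  qed
  then show "penalized_loss S \<eta> (geodesic A B t) < (1 - t) * penalized_loss S \<eta> A + t * penalized_loss S \<eta> B"
    unfolding G unfolding AM BM F by (simp add: algebra_simps sum_distrib_left)
qed

section \<open>The sample covariance matrix\<close>

lemma outer_prod_mult_vec: "outer_prod u w *v v = (w \<bullet> v) *\<^sub>R u"
  by (simp add: vec_eq_iff outer_prod_def matrix_matrix_mult_def columnvector_def rowvector_def
      matrix_vector_mult_def inner_vec_def sum_distrib_left sum_distrib_right algebra_simps)

lemma transpose_sample_cov: "transpose (sample_cov n x) = sample_cov n x"
  by (simp add: vec_eq_iff transpose_def sample_cov_def outer_prod_def matrix_matrix_mult_def
      columnvector_def rowvector_def mult.commute)

lemma sum_outer_prod_mult_vec:
  "(\<Sum>i\<in>I. outer_prod (y i) (y i)) *v v = (\<Sum>i\<in>I. (y i \<bullet> v) *\<^sub>R y i)"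
  by (induction I rule: infinite_finite_induct)
     (simp_all add: matrix_vector_mult_add_rdistrib outer_prod_mult_vec)

lemma sample_cov_mult_vec:
  "sample_cov n x *v v
     = (1 / real n) *\<^sub>R (\<Sum>i=1..n. ((x i - sample_mean n x) \<bullet> v) *\<^sub>R (x i - sample_mean n x))"
  by (simp only: sample_cov_def scaleR_matrix_vector_assoc[symmetric] sum_outer_prod_mult_vec)

lemma sample_cov_quadratic_form:
  "v \<bullet> (sample_cov n x *v v) = (1 / real n) * (\<Sum>i=1..n. ((x i - sample_mean n x) \<bullet> v)\<^sup>2)"
  unfolding sample_cov_mult_vec
  by (simp add: inner_sum_right power2_eq_square inner_commute)

lemma sample_cov_psd: "0 \<le> v \<bullet> (sample_cov n x *v v)"
  unfolding sample_cov_quadratic_form by (simp add: sum_nonneg)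

text \<open>
  A vector on which the quadratic form vanishes is orthogonal to all centred observations, hence in the kernel.
\<close>

lemma sample_cov_pos_def:
  assumes "invertible (sample_cov n x)"
  shows "pos_def (sample_cov n x)"
  unfolding pos_def_def
proof (intro conjI allI impI transpose_sample_cov)
  fix v :: "real^'a"
  assume v: "v \<noteq> 0"
  show "0 < v \<bullet> (sample_cov n x *v v)"
  proof (rule ccontr)
    assume "\<not> ?thesis"
    then have "v \<bullet> (sample_cov n x *v v) = 0"
      using sample_cov_psd[of v n x] by simp
    then have "n = 0 \<or> (\<forall>i\<in>{1..n}. ((x i - sample_mean n x) \<bullet> v)\<^sup>2 = 0)"
      unfolding sample_cov_quadratic_form by (auto simp: sum_nonneg_eq_0_iff simp del: zero_eq_power2)
    then have "sample_cov n x *v v = 0"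
      unfolding sample_cov_mult_vec by auto
    then have "matrix_inv (sample_cov n x) *v (sample_cov n x *v v) = 0"
      by simp
    then show False
      using v by (simp add: matrix_vector_mul_assoc invertible_mult_matrix_inv[OF assms])
  qed
qed

section \<open>Coercivity and existence of a minimizer\<close>

lemma penalized_loss_spectral:
  fixes U :: "real^'n^'n"
  assumes U: "orthogonal_matrix U"
  shows "penalized_loss S \<eta> (exp_conj U d)
       = (\<Sum>i\<in>UNIV. exp (- d $ i) * (column i U \<bullet> (S *v column i U)) + d $ i + \<eta> * (d $ i)\<^sup>2)"
proof -
  have "ln \<bar>det U\<bar> = 0"
    using det_orthogonal_matrix[OF U] by auto
  then show ?thesis
    by (simp add: penalized_loss_exp_conj[OF orthogonal_matrix_invertible[OF U]] orthogonal_matrix_inv[OF U]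
        norm_mat_log_exp_conj[OF U] norm_square_vec sum.distrib sum_distrib_left)
qed

lemma pos_def_lower_bound:
  fixes A :: "real^'n^'n"
  assumes A: "pos_def A"
  obtains m where "m > 0" "\<And>v. m * (norm v)\<^sup>2 \<le> v \<bullet> (A *v v)"
proof -
  obtain U d where U: "orthogonal_matrix U" and Ad: "A = exp_conj U d"
    using pos_def_spectral[OF A] by blast
  define m where "m = Min (range (\<lambda>i. exp (d $ i)))"
  have m: "m \<le> exp (d $ i)" for i
    unfolding m_def by (intro Min_le) auto
  have "m \<in> range (\<lambda>i. exp (d $ i))"
    unfolding m_def by (intro Min_in) auto
  then have "m > 0"
    by auto
  moreover have "m * (norm v)\<^sup>2 \<le> v \<bullet> (A *v v)" for v
  proof -
    have "U ** diag_mat (\<chi> i. 1) ** transpose U = mat 1"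
      using U by (simp add: diag_mat_one orthogonal_matrix_def)
    then have "(norm v)\<^sup>2 = (\<Sum>i\<in>UNIV. ((transpose U *v v) $ i)\<^sup>2)"
      using inner_diag_conj[of v U "\<chi> i. 1"] by (simp add: power2_norm_eq_inner del: transpose_matrix_vector)
    then have "m * (norm v)\<^sup>2 = (\<Sum>i\<in>UNIV. m * ((transpose U *v v) $ i)\<^sup>2)"
      by (simp add: sum_distrib_left)
    also have "\<dots> \<le> (\<Sum>i\<in>UNIV. exp (d $ i) * ((transpose U *v v) $ i)\<^sup>2)"
      by (intro sum_mono mult_right_mono m) auto
    also have "\<dots> = v \<bullet> (A *v v)"
      by (simp add: Ad exp_conj_def inner_diag_conj del: transpose_matrix_vector)
    finally show ?thesis .
  qed
  ultimately show thesis
    using that by blast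
qed

lemma norm_column_orthogonal: "orthogonal_matrix (U :: real^'n^'n) \<Longrightarrow> norm (column i U) = 1"
  by (simp add: orthogonal_matrix_orthonormal_columns)

text \<open>
  Every logarithmic eigenvalue \<open>y\<close> contributes at least \<open>\<bar>y\<bar>\<close> minus a constant, by completing a square: for
  \<open>\<eta> > 0\<close> in \<open>y + \<eta> y\<^sup>2\<close>, and otherwise in the quadratic Taylor bound for \<open>s exp (- y) + y\<close> at negative \<open>y\<close>, where \<open>s\<close> is a
  lower bound of the spectrum of \<open>S\<close>.
\<close>

theorem penalized_loss_lower_bound:
  fixes S :: "real^'n^'n"
  assumes psd: "\<And>v. 0 \<le> v \<bullet> (S *v v)" and \<eta>: "\<eta> \<ge> 0" and strict: "pos_def S \<or> \<eta> > 0"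
  obtains K where "\<And>A. pos_def A \<Longrightarrow> norm (mat_log A) - K \<le> penalized_loss S \<eta> A"
proof -
  obtain c where c: "\<And>v y. norm v = 1 \<Longrightarrow> \<bar>y\<bar> - c \<le> exp (- y) * (v \<bullet> (S *v v)) + y + \<eta> * y\<^sup>2"
  proof (cases "\<eta> > 0")
    case True
    show thesis
    proof (rule that[of "1 / \<eta>"])
      fix v :: "real^'n" and y :: real
      have "0 \<le> \<eta> * (\<bar>y\<bar> - 1 / \<eta>)\<^sup>2"
        using True by simp
      also have "\<dots> = \<eta> * y\<^sup>2 - 2 * \<bar>y\<bar> + 1 / \<eta>"
        using True by (simp add: power2_diff field_simps power2_eq_square)
      finally have "\<bar>y\<bar> - 1 / \<eta> \<le> y + \<eta> * y\<^sup>2"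
        by linarith
      moreover have "0 \<le> exp (- y) * (v \<bullet> (S *v v))"
        using psd by simp
      ultimately show "\<bar>y\<bar> - 1 / \<eta> \<le> exp (- y) * (v \<bullet> (S *v v)) + y + \<eta> * y\<^sup>2"
        by linarith
    qed
  next
    case False
    then obtain s where s: "s > 0" and sv: "\<And>v. s * (norm v)\<^sup>2 \<le> v \<bullet> (S *v v)"
      using strict pos_def_lower_bound by metis
    show thesis
    proof (rule that[of "2 / s"])
      fix v :: "real^'n" and y :: real
      assume "norm v = 1"
      then have "exp (- y) * s \<le> exp (- y) * (v \<bullet> (S *v v))"
        using sv[of v] by simp
      moreover have "\<bar>y\<bar> - 2 / s \<le> exp (- y) * s + y"
      proof (cases "y \<ge> 0")
        case True
        have "0 \<le> exp (- y) * s" "0 \<le> 2 / s"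
          using s by auto
        with True show ?thesis
          by linarith
      next
        case False
        have "0 \<le> (s / 2) * (- y - 2 / s)\<^sup>2"
          using s by simp
        also have "\<dots> = s * ((- y)\<^sup>2 / 2) + 2 * y + 2 / s"
          using s by (simp add: power2_diff field_simps power2_eq_square)
        also have "\<dots> \<le> s * exp (- y) + 2 * y + 2 / s"
          using exp_lower_Taylor_quadratic[of "- y"] False s
          by (intro add_right_mono mult_left_mono) auto
        finally show ?thesis
          using False by (simp add: mult.commute)
      qed
      moreover have "0 \<le> \<eta> * y\<^sup>2"
        using \<eta> by simp
      ultimately show "\<bar>y\<bar> - 2 / s \<le> exp (- y) * (v \<bullet> (S *v v)) + y + \<eta> * y\<^sup>2"
        by linarith
    qed
  qed
  show thesis
  proof (rule that[of "CARD('n) * c"])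
    fix A :: "real^'n^'n"
    assume "pos_def A"
    then obtain U d where U: "orthogonal_matrix U" and A: "A = exp_conj U d"
      using pos_def_spectral by blast
    have "norm (mat_log A) \<le> (\<Sum>i\<in>UNIV. \<bar>d $ i\<bar>)"
      by (simp add: A norm_mat_log_exp_conj[OF U] norm_le_l1_cart)
    moreover have "(\<Sum>i\<in>UNIV. \<bar>d $ i\<bar> - c) \<le> penalized_loss S \<eta> A"
      unfolding A penalized_loss_spectral[OF U]
      by (intro sum_mono c norm_column_orthogonal U)
    ultimately show "norm (mat_log A) - CARD('n) * c \<le> penalized_loss S \<eta> A"
      by (simp add: sum_subtractf)
  qed
qed

lemma compact_orthogonal_matrices: "compact {U :: real^'n^'n. orthogonal_matrix U}"
  unfolding compact_eq_bounded_closed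
proof
  show "bounded {U :: real^'n^'n. orthogonal_matrix U}"
    unfolding bounded_iff
  proof (intro exI ballI)
    fix U :: "real^'n^'n"
    assume "U \<in> {U. orthogonal_matrix U}"
    then have "U \<bullet> U = CARD('n)"
      by (simp add: inner_matrix_eq_trace orthogonal_matrix_def trace_I)
    then show "norm U \<le> sqrt (CARD('n))"
      by (simp add: norm_eq_sqrt_inner)
  qed
  have "{U :: real^'n^'n. orthogonal_matrix U}
      = {U. \<forall>i j. (\<Sum>k\<in>UNIV. U $ k $ i * U $ k $ j) = mat 1 $ i $ j}"
    by (simp add: orthogonal_matrix vec_eq_iff matrix_matrix_mult_def transpose_def)
  moreover have "closed \<dots>"
    by (intro closed_Collect_all closed_Collect_eq continuous_intros)
  ultimately show "closed {U :: real^'n^'n. orthogonal_matrix U}"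
    by simp
qed

text \<open>
  Minimizing over the pair of eigenbasis and logarithmic eigenvalues avoids any discussion of the
  continuity of the matrix logarithm. The radius \<open>R\<close> is such that outside the ball the loss exceeds its value at the
  identity.
\<close>

lemma penalized_loss_attains_min:
  fixes S :: "real^'n^'n"
  assumes K: "\<And>A. pos_def A \<Longrightarrow> norm (mat_log A) - K \<le> penalized_loss S \<eta> A"
  obtains A where "pos_def A" "\<And>B. pos_def B \<Longrightarrow> penalized_loss S \<eta> A \<le> penalized_loss S \<eta> B"
proof -
  define F where "F = (penalized_loss S \<eta>)"
  define R where "R = max 0 (F (exp_conj (mat 1) 0) + K)"
  define C where "C = {U :: real^'n^'n. orthogonal_matrix U} \<times> cball (0 :: real^'n) R"
  define f where "f = (\<lambda>p :: (real^'n^'n) \<times> (real^'n).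
    \<Sum>i\<in>UNIV. exp (- snd p $ i) * ((\<chi> k. fst p $ k $ i) \<bullet> (S *v (\<chi> k. fst p $ k $ i))) + snd p $ i + \<eta> * (snd p $ i)\<^sup>2)"
  have fF: "f (U, d) = F (exp_conj U d)" if "orthogonal_matrix U" for U d
    unfolding F_def penalized_loss_spectral[OF that] f_def column_def by simp
  have "compact C"
    unfolding C_def by (intro compact_Times compact_orthogonal_matrices compact_cball)
  moreover have I: "(mat 1, 0) \<in> C"
    by (simp add: C_def orthogonal_matrix_id R_def)
  moreover have "continuous_on C f"
    unfolding f_def
    by (intro continuous_intros bounded_linear.continuous_on[OF matrix_vector_mul_bounded_linear])
  ultimately obtain p where p: "p \<in> C" and min: "\<And>r. r \<in> C \<Longrightarrow> f p \<le> f r"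
    using continuous_attains_inf[of C f] by (metis empty_iff)
  obtain U d where pUd: "p = (U, d)"
    by (cases p)
  have U: "orthogonal_matrix U"
    using p by (simp add: pUd C_def)
  show thesis
  proof (rule that[of "exp_conj U d"])
    show "pos_def (exp_conj U d)"
      by (intro pos_def_exp_conj orthogonal_matrix_invertible U)
    fix B :: "real^'n^'n"
    assume B: "pos_def B"
    then obtain V e where V: "orthogonal_matrix V" and Be: "B = exp_conj V e"
      using pos_def_spectral by blast
    have "F (exp_conj U d) \<le> F B"
    proof (cases "norm e \<le> R")
      case True
      then show ?thesis
        using min[of "(V, e)"] V by (simp add: C_def pUd fF U Be)
    next
      case False
      have "F (exp_conj U d) \<le> F (exp_conj (mat 1) 0)"
        using min[OF I] by (simp add: pUd fF U orthogonal_matrix_id)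
      also have "\<dots> \<le> norm (mat_log B) - K"
        using False by (simp add: Be norm_mat_log_exp_conj[OF V] R_def)
      also have "\<dots> \<le> F B"
        unfolding F_def by (rule K[OF B])
      finally show ?thesis .
    qed
    then show "penalized_loss S \<eta> (exp_conj U d) \<le> penalized_loss S \<eta> B"
      by (simp add: F_def)
  qed
qed

section \<open>Critical points and minimizers\<close>

text \<open>
  Along the geodesic from \<open>A\<close> to \<open>B\<close> the difference quotient of \<open>F\<close> at \<open>A\<close> tends to zero, while convexity bounds it
  by \<open>F B - F A\<close>.
\<close>

lemma critical_point_imp_minimum:
  fixes F :: "real^'n^'n \<Rightarrow> real"
  assumes F: "strictly_g_convex F" and A: "critical_point F A" and B: "pos_def B"
  shows "F A \<le> F B"
proof (cases "A = B")
  case False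
  have pA: "pos_def A" and dF: "(F has_derivative (\<lambda>H. 0)) (at A within {A. pos_def A})"
    using A by (auto simp: critical_point_def has_pd_gradient_def)
  obtain M \<mu> where M: "invertible M" and AM: "A = exp_conj M 0" and BM: "B = exp_conj M \<mu>"
    and G: "\<And>t. geodesic A B t = exp_conj M (t *\<^sub>R \<mu>)"
    using geodesic_eq_exp_conj[OF pA B] by metis
  define \<gamma> where "\<gamma> = (\<lambda>t. exp_conj M (t *\<^sub>R \<mu>))"
  define E :: "'n \<Rightarrow> real^'n^'n" where "E = (\<lambda>k. \<chi> i j. M $ i $ k * M $ j $ k)"
  have "(X ** transpose M) $ i $ j = (\<Sum>k\<in>UNIV. X $ i $ k * M $ j $ k)" for X :: "real^'n^'n" and i j
    by (simp add: matrix_matrix_mult_def transpose_def)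
  then have "\<gamma> t = (\<Sum>k\<in>UNIV. exp (t * \<mu> $ k) *\<^sub>R E k)" for t
    by (simp add: vec_eq_iff \<gamma>_def E_def exp_conj_def diag_mat_mult_right mult_ac)
  then have "\<gamma> = (\<lambda>t. \<Sum>k\<in>UNIV. exp (t * \<mu> $ k) *\<^sub>R E k)"
    by (rule ext)
  then have "(\<gamma> has_vector_derivative (\<Sum>k\<in>UNIV. \<mu> $ k *\<^sub>R E k)) (at 0)"
    by (auto intro!: derivative_eq_intros)
  then have "(\<gamma> has_derivative (\<lambda>h. h *\<^sub>R (\<Sum>k\<in>UNIV. \<mu> $ k *\<^sub>R E k))) (at 0)"
    by (simp add: has_vector_derivative_def)
  moreover have "(F has_derivative (\<lambda>H. 0)) (at (\<gamma> 0) within range \<gamma>)"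
    using has_derivative_subset[OF dF, of "range \<gamma>"] pos_def_exp_conj[OF M]
    by (auto simp: \<gamma>_def AM)
  ultimately have "((\<lambda>t. F (\<gamma> t)) has_derivative (\<lambda>h. 0)) (at 0)"
    using has_derivative_in_compose by fastforce
  then have "((\<lambda>t. F (\<gamma> t)) has_real_derivative 0) (at 0)"
    unfolding has_field_derivative_def lambda_zero[symmetric] .
  then have "((\<lambda>t. (F (\<gamma> t) - F (\<gamma> 0)) / t) \<longlongrightarrow> 0) (at_right 0)"
    by (auto simp: has_field_derivative_iff intro: filterlim_mono at_le)
  moreover have "eventually (\<lambda>t. (F (\<gamma> t) - F (\<gamma> 0)) / t \<le> F B - F A) (at_right 0)"
    unfolding eventually_at_right[OF zero_less_one]
  proof (intro exI conjI allI impI)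
    fix t :: real
    assume t: "0 < t" "t < 1"
    then have "F (\<gamma> t) < (1 - t) * F A + t * F B"
      using F pA B False G unfolding strictly_g_convex_def \<gamma>_def by metis
    then show "(F (\<gamma> t) - F (\<gamma> 0)) / t \<le> F B - F A"
      using t by (simp add: field_simps \<gamma>_def AM)
  qed simp
  ultimately have "0 \<le> F B - F A"
    by (rule tendsto_upperbound) simp
  then show ?thesis
    by simp
qed simp

lemma strictly_g_convex_unique_minimum:
  assumes F: "strictly_g_convex F" and A: "pos_def A" and B: "pos_def B"
    and min: "\<And>C. pos_def C \<Longrightarrow> F A \<le> F C" and le: "F B \<le> F A"
  shows "A = B"
proof (rule ccontr)
  assume "A \<noteq> B"
  then have less: "F (geodesic A B (1/2)) < (1 - 1/2) * F A + 1/2 * F B"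
    using F[unfolded strictly_g_convex_def, rule_format, OF A B, of "1/2"] by simp
  obtain M \<mu> where "invertible M" "geodesic A B (1/2) = exp_conj M ((1/2) *\<^sub>R \<mu>)"
    using geodesic_eq_exp_conj[OF A B] by metis
  then have "F A \<le> F (geodesic A B (1/2))"
    by (simp add: min pos_def_exp_conj)
  with less le show False
    by simp
qed

section \<open>A quadratic upper bound for the loss\<close>

lemma norm_matrix_vector_le:
  fixes A :: "real^'n^'m"
  shows "norm (A *v v) \<le> norm A * norm v"
proof (rule power2_le_imp_le)
  have "(norm (A *v v))\<^sup>2 = (\<Sum>i\<in>UNIV. (A $ i \<bullet> v)\<^sup>2)"
    by (simp add: norm_square_vec matrix_vector_mul_component)
  also have "\<dots> \<le> (\<Sum>i\<in>UNIV. (norm (A $ i))\<^sup>2 * (norm v)\<^sup>2)"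
    using Cauchy_Schwarz_ineq[of _ v] by (intro sum_mono) (simp add: power2_norm_eq_inner)
  also have "\<dots> = (norm A * norm v)\<^sup>2"
  proof -
    have "(norm A)\<^sup>2 = (\<Sum>i\<in>UNIV. (norm (A $ i))\<^sup>2)"
      by (simp add: power2_norm_eq_inner inner_vec_def)
    then show ?thesis
      by (simp add: power_mult_distrib sum_distrib_right)
  qed
  finally show "(norm (A *v v))\<^sup>2 \<le> (norm A * norm v)\<^sup>2" .
qed simp

lemma norm_transpose:
  fixes A :: "real^'n^'n"
  shows "norm (transpose A) = norm A"
  using trace_mul_sym[of A "transpose A"] by (simp add: norm_eq_sqrt_inner inner_matrix_eq_trace)

lemma norm_matrix_mult_le:
  fixes A B :: "real^'n^'n"
  shows "norm (A ** B) \<le> norm A * norm B"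
proof -
  have "norm (A ** B) = norm (transpose B ** transpose A)"
    by (metis matrix_transpose_mul norm_transpose)
  also have "\<dots> \<le> norm (transpose B) * norm A"
  proof (rule power2_le_imp_le)
    have rows: "(norm X)\<^sup>2 = (\<Sum>i\<in>UNIV. (norm (X $ i))\<^sup>2)" for X :: "real^'n^'n"
      by (simp add: power2_norm_eq_inner inner_vec_def)
    have "(transpose B ** transpose A) $ i = A *v (transpose B $ i)" for i
      by (simp add: vec_eq_iff matrix_matrix_mult_def matrix_vector_mult_def transpose_def mult.commute)
    then have "(norm (transpose B ** transpose A))\<^sup>2 \<le> (\<Sum>i\<in>UNIV. (norm A * norm (transpose B $ i))\<^sup>2)"
      unfolding rows[of "transpose B ** transpose A"]
      by (intro sum_mono power_mono) (simp_all add: norm_matrix_vector_le)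
    also have "\<dots> = (norm (transpose B) * norm A)\<^sup>2"
      by (simp add: power_mult_distrib rows sum_distrib_left mult.commute)
    finally show "(norm (transpose B ** transpose A))\<^sup>2 \<le> (norm (transpose B) * norm A)\<^sup>2" .
  qed simp
  finally show ?thesis
    by (simp add: norm_transpose mult.commute)
qed

lemma pos_def_perturb_lower_bound:
  fixes A B :: "real^'n^'n"
  assumes A: "\<And>v. m * (norm v)\<^sup>2 \<le> v \<bullet> (A *v v)"
  shows "(m - norm (B - A)) * (norm v)\<^sup>2 \<le> v \<bullet> (B *v v)"
proof -
  have "v \<bullet> ((A - B) *v v) \<le> norm v * (norm (A - B) * norm v)"
    by (meson norm_cauchy_schwarz mult_left_mono norm_ge_zero norm_matrix_vector_le order_trans)
  also have "\<dots> = norm (B - A) * (norm v)\<^sup>2"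
    by (simp add: norm_minus_commute power2_eq_square)
  finally show ?thesis
    using A[of v] by (simp add: matrix_vector_mult_diff_rdistrib inner_diff_right algebra_simps)
qed

lemma eigenvalue_lower_bound:
  fixes V :: "real^'n^'n"
  assumes V: "orthogonal_matrix V" and B: "\<And>v. m * (norm v)\<^sup>2 \<le> v \<bullet> (exp_conj V b *v v)"
  shows "m \<le> exp (b $ j)"
proof -
  have "transpose V ** exp_conj V b ** transpose (transpose V) = exp_conj (transpose V ** V) b"
    by (simp only: exp_conj_mult_left)
  also have "\<dots> = diag_mat (\<chi> i. exp (b $ i))"
    using V by (simp add: orthogonal_matrix_def exp_conj_def)
  finally have "column j V \<bullet> (exp_conj V b *v column j V) = exp (b $ j)"
    using diag_entry_congruence[of "transpose V" "exp_conj V b" j] by (simp add: diag_mat_def)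
  then show ?thesis
    using B[of "column j V"] by (simp add: norm_column_orthogonal[OF V])
qed

text \<open>
  First order expansions of \<open>ln\<close> and \<open>ln\<^sup>2\<close> at \<open>exp \<alpha>\<close>, evaluated at \<open>exp \<beta>\<close>. The remainder carries the factor
  \<open>exp (- \<beta>)\<close>, so it is uniform as long as \<open>exp \<beta>\<close> stays away from zero.
\<close>

lemma log_square_upper_expansion:
  fixes \<alpha> \<beta> :: real
  shows "\<beta> \<le> \<alpha> + exp (- \<alpha>) * (exp \<beta> - exp \<alpha>)"
    and "\<beta>\<^sup>2 \<le> \<alpha>\<^sup>2 + 2 * \<alpha> * exp (- \<alpha>) * (exp \<beta> - exp \<alpha>)
           + (2 * \<bar>\<alpha>\<bar> + 1) * (exp (- \<alpha>) * exp (- \<beta>) * (exp \<beta> - exp \<alpha>)\<^sup>2)"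
proof -
  define u where "u = \<beta> - \<alpha>"
  have \<beta>: "\<beta> = \<alpha> + u"
    by (simp add: u_def)
  have lin: "exp (- \<alpha>) * (exp \<beta> - exp \<alpha>) = exp u - 1"
    by (simp add: \<beta> right_diff_distrib flip: exp_add)
  have quad: "exp (- \<alpha>) * exp (- \<beta>) * (exp \<beta> - exp \<alpha>)\<^sup>2 = exp u + exp (- u) - 2"
    by (simp add: \<beta> power2_eq_square algebra_simps flip: exp_add)
  have up: "u \<le> exp u - 1" and lo: "1 - exp (- u) \<le> u"
    using exp_ge_add_one_self[of u] exp_ge_add_one_self[of "- u"] by linarith+
  show "\<beta> \<le> \<alpha> + exp (- \<alpha>) * (exp \<beta> - exp \<alpha>)"
    unfolding lin using up by (simp add: \<beta>)
  have "\<alpha> * u \<le> \<alpha> * (exp u - 1) + \<bar>\<alpha>\<bar> * (exp u + exp (- u) - 2)"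
  proof (cases "\<alpha> \<ge> 0")
    case True
    have "\<alpha> * u \<le> \<alpha> * (exp u - 1)"
      using True up by (rule mult_left_mono[rotated])
    moreover have "0 \<le> \<bar>\<alpha>\<bar> * (exp u + exp (- u) - 2)"
      using up lo by simp
    ultimately show ?thesis
      by linarith
  next
    case False
    then have "(- \<alpha>) * (1 - exp (- u)) \<le> (- \<alpha>) * u"
      using lo by (intro mult_left_mono) auto
    with False show ?thesis
      by (simp add: algebra_simps)
  qed
  moreover have "u\<^sup>2 \<le> exp u + exp (- u) - 2"
    by (rule square_le_exp_sum)
  moreover have "\<beta>\<^sup>2 = \<alpha>\<^sup>2 + 2 * (\<alpha> * u) + u\<^sup>2"
    by (simp add: \<beta> power2_eq_square algebra_simps)
  moreover have "2 * \<alpha> * exp (- \<alpha>) * (exp \<beta> - exp \<alpha>) = 2 * (\<alpha> * (exp u - 1))"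
    by (metis lin mult.assoc)
  ultimately show "\<beta>\<^sup>2 \<le> \<alpha>\<^sup>2 + 2 * \<alpha> * exp (- \<alpha>) * (exp \<beta> - exp \<alpha>)
      + (2 * \<bar>\<alpha>\<bar> + 1) * (exp (- \<alpha>) * exp (- \<beta>) * (exp \<beta> - exp \<alpha>)\<^sup>2)"
    unfolding quad by (simp add: algebra_simps)
qed

lemma matrix_mult_diff_left:
  fixes A B C :: "real^'n^'n"
  shows "(A - B) ** C = A ** C - B ** C"
  by (simp add: vec_eq_iff matrix_matrix_mult_def left_diff_distrib sum_subtractf)

lemma matrix_mult_diff_right:
  fixes A B C :: "real^'n^'n"
  shows "A ** (B - C) = A ** B - A ** C"
  by (simp add: vec_eq_iff matrix_matrix_mult_def right_diff_distrib sum_subtractf)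

text \<open>
  With \<open>D = B - A\<close> this rests on the exact second order resolvent identity
  \<open>B\<inverse> = A\<inverse> - A\<inverse> D A\<inverse> + A\<inverse> D B\<inverse> D A\<inverse>\<close>.
\<close>

lemma trace_inverse_upper_expansion:
  fixes A B S :: "real^'n^'n"
  assumes A: "pos_def A" and B: "pos_def B"
  shows "trace (matrix_inv B ** S) \<le> trace (matrix_inv A ** S)
       - (matrix_inv A ** transpose S ** matrix_inv A) \<bullet> (B - A)
       + (norm (matrix_inv A))\<^sup>2 * norm (matrix_inv B) * norm S * (norm (B - A))\<^sup>2"
proof -
  define A' where "A' = matrix_inv A"
  define B' where "B' = matrix_inv B"
  define D where "D = B - A"
  define E where "E = A' ** D ** B' ** D ** A'"
  obtain U a where U: "orthogonal_matrix U" and Aa: "A = exp_conj U a"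
    using pos_def_spectral[OF A] by blast
  obtain V b where V: "orthogonal_matrix V" and Bb: "B = exp_conj V b"
    using pos_def_spectral[OF B] by blast
  have inv: "A ** A' = mat 1" "A' ** A = mat 1" "B ** B' = mat 1" "B' ** B = mat 1"
    and sym: "transpose A' = A'"
    using U V unfolding A'_def B'_def Aa Bb
    by (simp_all add: matrix_inv_exp_conj_orthogonal exp_conj_add exp_conj_0 orthogonal_matrix_def)
  have AD: "A' ** D = A' ** B - mat 1"
    by (simp add: D_def matrix_mult_diff_right inv)
  have "A' ** D ** B' = A' ** (B ** B') - B'"
    by (simp add: AD matrix_mult_diff_left matrix_mul_assoc)
  then have ADB: "A' ** D ** B' = A' - B'"
    by (simp add: inv)
  have "E = (A' ** D) ** A' - (B' ** B) ** A' + B' ** (A ** A')"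
    unfolding E_def ADB by (simp add: D_def matrix_mult_diff_left matrix_mult_diff_right matrix_mul_assoc)
  then have "B' = A' - (A' - B' + (B' - A') + (A' ** D ** A' - E))"
    by (simp add: inv)
  then have B': "A' - A' ** D ** A' = B' - E"
    by (simp add: algebra_simps)
  have "trace (A' ** S) - trace (A' ** D ** A' ** S) = trace (B' ** S) - trace (E ** S)"
    by (metis B' matrix_mult_diff_left trace_sub)
  moreover have "trace (A' ** D ** A' ** S) = (A' ** transpose S ** A') \<bullet> D"
    unfolding inner_matrix_eq_trace
    by (simp add: matrix_transpose_mul sym trace_mul_sym[of "A' ** D" "A' ** S", unfolded matrix_mul_assoc] matrix_mul_assoc)
  moreover have "trace (E ** S) \<le> (norm A')\<^sup>2 * norm B' * norm S * (norm D)\<^sup>2"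
  proof -
    have "trace (E ** S) = transpose E \<bullet> S"
      by (simp add: inner_matrix_eq_trace)
    also have "\<dots> \<le> norm E * norm S"
      using norm_cauchy_schwarz[of "transpose E" S] by (simp add: norm_transpose)
    also have "norm E \<le> norm (A' ** D ** B' ** D) * norm A'"
      unfolding E_def by (rule norm_matrix_mult_le)
    also have "norm (A' ** D ** B' ** D) \<le> norm (A' ** D ** B') * norm D"
      by (rule norm_matrix_mult_le)
    also have "norm (A' ** D ** B') \<le> norm (A' ** D) * norm B'"
      by (rule norm_matrix_mult_le)
    also have "norm (A' ** D) \<le> norm A' * norm D"
      by (rule norm_matrix_mult_le)
    finally show ?thesis
      by (simp add: power2_eq_square mult_ac mult_right_mono)
  qed
  ultimately show ?thesis
    unfolding A'_def B'_def D_def by linarith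
qed

text \<open>
  A variant of Klein's trace inequality: the scalar expansion, applied to every pair of eigenvalues and averaged with
  the doubly stochastic weights, becomes an expansion of the trace function, because the averages of its linear and
  quadratic terms are the inner product with the difference and its squared Frobenius norm.
\<close>

lemma spectral_sum_upper_expansion:
  fixes U V :: "real^'n^'n"
  assumes U: "orthogonal_matrix U" and V: "orthogonal_matrix V" and \<eta>: "\<eta> \<ge> 0"
    and c: "\<And>j. exp (- b $ j) \<le> c" and \<kappa>: "\<And>i. \<eta> * (2 * \<bar>a $ i\<bar> + 1) * exp (- a $ i) \<le> \<kappa>"
  shows "(\<Sum>j\<in>UNIV. b $ j + \<eta> * (b $ j)\<^sup>2) \<le> (\<Sum>i\<in>UNIV. a $ i + \<eta> * (a $ i)\<^sup>2)
      + (U ** diag_mat (\<chi> i. exp (- a $ i) * (1 + 2 * \<eta> * a $ i)) ** transpose U) \<bullet> (exp_conj V b - exp_conj U a)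
      + \<kappa> * c * (norm (exp_conj V b - exp_conj U a))\<^sup>2"
proof -
  define W where "W = transpose U ** V"
  have W: "orthogonal_matrix W"
    unfolding W_def using U V by (simp add: orthogonal_matrix_mul)
  define w where "w = (\<lambda>i j. (W $ i $ j)\<^sup>2)"
  define h where "h = (\<lambda>x::real. x + \<eta> * x\<^sup>2)"
  define g where "g = (\<lambda>i. exp (- a $ i) * (1 + 2 * \<eta> * a $ i))"
  define G where "G = U ** diag_mat (\<chi> i. g i) ** transpose U"
  have wr: "(\<Sum>i\<in>UNIV. \<Sum>j\<in>UNIV. w i j * f i) = (\<Sum>i\<in>UNIV. f i)" for f
    using orthogonal_matrix_sum_squares(1)[OF W] by (simp add: w_def flip: sum_distrib_right)
  have wc: "(\<Sum>i\<in>UNIV. \<Sum>j\<in>UNIV. w i j * f j) = (\<Sum>j\<in>UNIV. f j)" for f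
    using orthogonal_matrix_sum_squares(2)[OF W]
    by (subst sum.swap) (simp add: w_def flip: sum_distrib_right)
  have pointwise: "h (b $ j) \<le> h (a $ i) + g i * (exp (b $ j) - exp (a $ i)) + \<kappa> * c * (exp (b $ j) - exp (a $ i))\<^sup>2" for i j
  proof -
    define \<Delta> where "\<Delta> = exp (b $ j) - exp (a $ i)"
    have "0 \<le> \<eta> * (2 * \<bar>a $ i\<bar> + 1) * exp (- a $ i)"
      using \<eta> by simp
    then have "\<eta> * (2 * \<bar>a $ i\<bar> + 1) * exp (- a $ i) * exp (- b $ j) \<le> \<kappa> * c"
      using \<kappa>[of i] by (intro mult_mono c) auto
    then have rem: "\<eta> * (2 * \<bar>a $ i\<bar> + 1) * exp (- a $ i) * exp (- b $ j) * \<Delta>\<^sup>2 \<le> \<kappa> * c * \<Delta>\<^sup>2"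
      by (rule mult_right_mono) simp
    show ?thesis
      using log_square_upper_expansion(1)[of "b $ j" "a $ i"]
        mult_left_mono[OF log_square_upper_expansion(2)[of "b $ j" "a $ i"] \<eta>] rem
      unfolding h_def g_def \<Delta>_def[symmetric] by (simp add: algebra_simps)
  qed
  have "(\<Sum>j\<in>UNIV. h (b $ j)) = (\<Sum>i\<in>UNIV. \<Sum>j\<in>UNIV. w i j * h (b $ j))"
    by (simp add: wc)
  also have "\<dots> \<le> (\<Sum>i\<in>UNIV. \<Sum>j\<in>UNIV. w i j * (h (a $ i) + g i * (exp (b $ j) - exp (a $ i))
      + \<kappa> * c * (exp (b $ j) - exp (a $ i))\<^sup>2))"
    by (intro sum_mono mult_left_mono pointwise) (simp add: w_def)
  also have "\<dots> = (\<Sum>i\<in>UNIV. \<Sum>j\<in>UNIV. w i j * h (a $ i))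
      + (\<Sum>i\<in>UNIV. \<Sum>j\<in>UNIV. w i j * (g i * exp (b $ j)))
      - (\<Sum>i\<in>UNIV. \<Sum>j\<in>UNIV. w i j * (g i * exp (a $ i)))
      + \<kappa> * c * (\<Sum>i\<in>UNIV. \<Sum>j\<in>UNIV. w i j * (exp (b $ j) - exp (a $ i))\<^sup>2)"
    by (simp add: right_diff_distrib distrib_left sum.distrib sum_subtractf sum_distrib_left mult_ac)
  also have "(\<Sum>i\<in>UNIV. \<Sum>j\<in>UNIV. w i j * h (a $ i)) = (\<Sum>i\<in>UNIV. h (a $ i))"
    by (rule wr)
  also have "(\<Sum>i\<in>UNIV. \<Sum>j\<in>UNIV. w i j * (g i * exp (a $ i))) = (\<Sum>i\<in>UNIV. g i * exp (a $ i))"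
    by (rule wr)
  also have "(\<Sum>i\<in>UNIV. g i * exp (a $ i)) = G \<bullet> exp_conj U a"
    unfolding inner_matrix_eq_trace G_def exp_conj_def using U
    by (simp add: matrix_transpose_mul trace_diag_conj_mult[unfolded matrix_mul_assoc] matrix_mul_assoc orthogonal_matrix_def)
       (simp add: mat_def if_distrib[of "\<lambda>r. r\<^sup>2"] if_distrib[of "\<lambda>r. r * _"] cong: if_cong)
  also have "(\<Sum>i\<in>UNIV. \<Sum>j\<in>UNIV. w i j * (g i * exp (b $ j))) = G \<bullet> exp_conj V b"
    unfolding inner_matrix_eq_trace G_def exp_conj_def w_def W_def
    by (simp add: matrix_transpose_mul trace_diag_conj_mult[unfolded matrix_mul_assoc] matrix_mul_assoc)
  also have "(\<Sum>i\<in>UNIV. \<Sum>j\<in>UNIV. w i j * (exp (b $ j) - exp (a $ i))\<^sup>2) = (norm (exp_conj V b - exp_conj U a))\<^sup>2"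
    unfolding norm_minus_commute[of "exp_conj V b"]
    unfolding exp_conj_def norm_diag_conj_diff[OF U V] w_def W_def
    by (simp add: power2_commute)
  finally show ?thesis
    unfolding h_def G_def g_def by (simp add: inner_diff_right)
qed

lemma norm_diag_conj: "orthogonal_matrix U \<Longrightarrow> norm (U ** diag_mat d ** transpose U) = norm d"
  by (simp add: norm_mat_log_exp_conj flip: mat_log_exp_conj)

text \<open>
  The constants depend on \<open>B\<close> only through a lower bound for its spectrum, which is at least \<open>m / 2\<close> for \<open>B\<close> within
  distance \<open>m / 2\<close> of \<open>A\<close>, where \<open>m\<close> is a lower bound for the spectrum of \<open>A\<close>.
\<close>

theorem penalized_loss_upper_expansion:
  fixes S :: "real^'n^'n"
  assumes sym: "transpose S = S" and \<eta>: "\<eta> \<ge> 0" and A: "pos_def A"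
  obtains G C \<delta> where "transpose G = G" "C \<ge> 0" "\<delta> > 0"
    "\<And>B. pos_def B \<Longrightarrow> norm (B - A) < \<delta> \<Longrightarrow>
       penalized_loss S \<eta> B \<le> penalized_loss S \<eta> A + G \<bullet> (B - A) + C * (norm (B - A))\<^sup>2"
proof -
  obtain U a where U: "orthogonal_matrix U" and Aa: "A = exp_conj U a"
    using pos_def_spectral[OF A] by blast
  obtain m where m: "m > 0" and Am: "\<And>v. m * (norm v)\<^sup>2 \<le> v \<bullet> (A *v v)"
    using pos_def_lower_bound[OF A] by blast
  define T where "T = (\<lambda>B. trace (matrix_inv B ** S))"
  have F: "penalized_loss S \<eta> (exp_conj V b) = T (exp_conj V b) + (\<Sum>j\<in>UNIV. b $ j + \<eta> * (b $ j)\<^sup>2)"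
    if V: "orthogonal_matrix V" for V :: "real^'n^'n" and b
  proof -
    have "ln \<bar>det V\<bar> = 0"
      using det_orthogonal_matrix[OF V] by auto
    then show ?thesis
      by (simp add: penalized_loss_def riem_penalty_def T_def norm_mat_log_exp_conj[OF V] norm_square_vec
          ln_det_exp_conj[OF orthogonal_matrix_invertible[OF V]] sum.distrib sum_distrib_left)
  qed
  define \<kappa> where "\<kappa> = (\<Sum>i\<in>UNIV. \<eta> * (2 * \<bar>a $ i\<bar> + 1) * exp (- a $ i))"
  have \<kappa>: "\<eta> * (2 * \<bar>a $ i\<bar> + 1) * exp (- a $ i) \<le> \<kappa>" for i
    unfolding \<kappa>_def using \<eta> by (intro member_le_sum) auto
  define c where "c = 2 / m"
  define G1 where "G1 = U ** diag_mat (\<chi> i. exp (- a $ i) * (1 + 2 * \<eta> * a $ i)) ** transpose U"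
  define G2 where "G2 = matrix_inv A ** transpose S ** matrix_inv A"
  define C2 where "C2 = (norm (matrix_inv A))\<^sup>2 * (real CARD('n) * c) * norm S"
  have "\<kappa> \<ge> 0"
    unfolding \<kappa>_def using \<eta> by (intro sum_nonneg) auto
  show thesis
  proof (rule that[of "G1 - G2" "\<kappa> * c + C2" "m / 2"])
    have "transpose (matrix_inv A) = matrix_inv A"
      unfolding Aa matrix_inv_exp_conj_orthogonal[OF U] by simp
    then have "transpose G1 = G1" "transpose G2 = G2"
      by (simp_all add: G1_def G2_def matrix_transpose_mul matrix_mul_assoc sym)
    then show "transpose (G1 - G2) = G1 - G2"
      by (simp add: vec_eq_iff transpose_def)
    show "\<kappa> * c + C2 \<ge> 0" "m / 2 > 0"
      using \<open>\<kappa> \<ge> 0\<close> m by (auto simp: C2_def c_def)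
    fix B :: "real^'n^'n"
    assume B: "pos_def B" and near: "norm (B - A) < m / 2"
    obtain V b where V: "orthogonal_matrix V" and Bb: "B = exp_conj V b"
      using pos_def_spectral[OF B] by blast
    have "m / 2 * (norm v)\<^sup>2 \<le> v \<bullet> (B *v v)" for v
      by (rule order_trans[OF mult_right_mono pos_def_perturb_lower_bound[OF Am]]) (use near in auto)
    then have "m / 2 \<le> exp (b $ j)" for j
      using eigenvalue_lower_bound[OF V, of "m / 2" b j] Bb by blast
    then have bc: "exp (- b $ j) \<le> c" for j
      using m unfolding c_def by (simp add: exp_minus field_simps)
    have "norm (matrix_inv B) = norm (\<chi> j. exp (- b $ j))"
      unfolding Bb matrix_inv_exp_conj_orthogonal[OF V] 
      unfolding exp_conj_def norm_diag_conj[OF V] by simp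
    also have "\<dots> \<le> (\<Sum>j\<in>UNIV. \<bar>(\<chi> j. exp (- b $ j)) $ j\<bar>)"
      by (rule norm_le_l1_cart)
    also have "\<dots> \<le> real CARD('n) * c"
      using bc by (intro sum_bounded_above) auto
    finally have "(norm (matrix_inv A))\<^sup>2 * norm (matrix_inv B) * norm S * (norm (B - A))\<^sup>2 \<le> C2 * (norm (B - A))\<^sup>2"
      unfolding C2_def by (intro mult_right_mono mult_left_mono) auto
    then have "T B \<le> T A - G2 \<bullet> (B - A) + C2 * (norm (B - A))\<^sup>2"
      using trace_inverse_upper_expansion[OF A B, of S] unfolding T_def G2_def by linarith
    moreover have "(\<Sum>j\<in>UNIV. b $ j + \<eta> * (b $ j)\<^sup>2) \<le> (\<Sum>i\<in>UNIV. a $ i + \<eta> * (a $ i)\<^sup>2)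
        + G1 \<bullet> (B - A) + \<kappa> * c * (norm (B - A))\<^sup>2"
      unfolding Aa Bb G1_def by (rule spectral_sum_upper_expansion[OF U V \<eta> bc \<kappa>])
    moreover have "penalized_loss S \<eta> B = T B + (\<Sum>j\<in>UNIV. b $ j + \<eta> * (b $ j)\<^sup>2)"
      unfolding Bb by (rule F[OF V])
    moreover have "penalized_loss S \<eta> A = T A + (\<Sum>i\<in>UNIV. a $ i + \<eta> * (a $ i)\<^sup>2)"
      unfolding Aa by (rule F[OF U])
    ultimately show "penalized_loss S \<eta> B
        \<le> penalized_loss S \<eta> A + (G1 - G2) \<bullet> (B - A) + (\<kappa> * c + C2) * (norm (B - A))\<^sup>2"
      by (simp add: inner_diff_left distrib_right)
  qed
qed

section \<open>Existence and uniqueness of the critical point\<close>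

text \<open>
  A nonzero \<open>G\<close> would make \<open>F\<close> smaller at \<open>A - s G\<close> for small \<open>s > 0\<close>. Hence \<open>G = 0\<close>, and
  \<open>0 \<le> F B - F A \<le> C \<parallel>B - A\<parallel>\<^sup>2\<close> gives the vanishing derivative.
\<close>

lemma minimum_imp_critical_point:
  fixes F :: "real^'n^'n \<Rightarrow> real"
  assumes A: "pos_def A" and min: "\<And>B. pos_def B \<Longrightarrow> F A \<le> F B"
    and G: "transpose G = G" and C: "C \<ge> 0" and \<delta>: "\<delta> > 0"
    and up: "\<And>B. pos_def B \<Longrightarrow> norm (B - A) < \<delta> \<Longrightarrow> F B \<le> F A + G \<bullet> (B - A) + C * (norm (B - A))\<^sup>2"
  shows "critical_point F A"
proof -
  obtain m where m: "m > 0" and Am: "\<And>v. m * (norm v)\<^sup>2 \<le> v \<bullet> (A *v v)"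
    using pos_def_lower_bound[OF A] by blast
  have "G = 0"
  proof (rule ccontr)
    assume "G \<noteq> 0"
    then have nG: "norm G > 0"
      by simp
    \<comment> \<open>\<open>r\<close> keeps \<open>A - s G\<close> positive definite and in the range of the upper bound; the other bound on \<open>s\<close> makes the linear term dominate.\<close>
    define r where "r = min \<delta> m / (2 * norm G)"
    define s where "s = min r (1 / (2 * (C + 1)))"
    have s: "s > 0"
      unfolding s_def r_def using nG m \<delta> C by simp
    have "s * norm G \<le> r * norm G"
      using nG by (simp add: s_def)
    also have "\<dots> = min \<delta> m / 2"
      using nG by (simp add: r_def)
    finally have small: "s * norm G < \<delta>" "s * norm G < m"
      using \<delta> m by auto
    define B where "B = A - s *\<^sub>R G"
    have nB: "norm (B - A) = s * norm G"
      using s by (simp add: B_def)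
    have "pos_def B"
      unfolding pos_def_def
    proof (intro conjI allI impI)
      show "transpose B = B"
        using A G by (simp add: B_def pos_def_def vec_eq_iff transpose_def)
      fix v :: "real^'n"
      assume "v \<noteq> 0"
      then have "0 < (m - norm (B - A)) * (norm v)\<^sup>2"
        using small by (simp add: nB)
      also have "\<dots> \<le> v \<bullet> (B *v v)"
        by (rule pos_def_perturb_lower_bound[OF Am])
      finally show "0 < v \<bullet> (B *v v)" .
    qed
    then have "F A \<le> F A + G \<bullet> (B - A) + C * (norm (B - A))\<^sup>2"
      using min[of B] up[of B] small by (simp add: nB)
    moreover have "G \<bullet> (B - A) = - (s * (norm G)\<^sup>2)"
      by (simp add: B_def power2_norm_eq_inner)
    ultimately have "s * (norm G)\<^sup>2 * 1 \<le> s * (norm G)\<^sup>2 * (C * s)"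
      by (simp add: nB power2_eq_square algebra_simps)
    then have "1 \<le> C * s"
      using s nG by (subst (asm) mult_le_cancel_left_pos) auto
    also have "\<dots> \<le> C * (1 / (2 * (C + 1)))"
      using C by (intro mult_left_mono) (auto simp: s_def)
    also have "\<dots> < 1"
      using C by (simp add: field_simps)
    finally show False
      by simp
  qed
  have "(F has_derivative (\<lambda>H. 0)) (at A within {A. pos_def A})"
    unfolding has_derivative_within_alt
  proof (intro conjI allI impI)
    fix e :: real
    assume e: "e > 0"
    have "norm (F B - F A - 0) \<le> e * norm (B - A)"
      if B: "pos_def B" and near: "norm (B - A) < min \<delta> (e / (C + 1))" for B
    proof -
      have "norm (B - A) * (C + 1) \<le> e"
        using near C by (simp add: field_simps)
      moreover have "C * norm (B - A) \<le> norm (B - A) * (C + 1)"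
        by (simp add: algebra_simps)
      ultimately have "C * norm (B - A) * norm (B - A) \<le> e * norm (B - A)"
        by (intro mult_right_mono) auto
      moreover have "0 \<le> F B - F A" "F B - F A \<le> C * norm (B - A) * norm (B - A)"
        using min[OF B] up[OF B] near by (auto simp: \<open>G = 0\<close> power2_eq_square)
      ultimately show ?thesis
        by simp
    qed
    then show "\<exists>d>0. \<forall>B\<in>{A. pos_def A}. norm (B - A) < d \<longrightarrow> norm (F B - F A - 0) \<le> e * norm (B - A)"
      using \<delta> e C by (intro exI[of _ "min \<delta> (e / (C + 1))"]) auto
  qed simp
  then show ?thesis
    using A by (simp add: critical_point_def has_pd_gradient_def transpose_def vec_eq_iff)
qed

theorem mainTheorem7:
  fixes x :: "nat \<Rightarrow> real^'q" and n :: nat and S :: "real^'q^'q" and \<eta> :: real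
  assumes S_def: "S = sample_cov n x"
    and S_nonzero: "S \<noteq> 0"
    and eta_nonneg: "\<eta> \<ge> 0"
    and eta_pos: "\<not> invertible S \<Longrightarrow> \<eta> > 0"
  shows "strictly_g_convex (penalized_loss S \<eta>)
    \<and> g_coercive (penalized_loss S \<eta>)
    \<and> (\<exists>\<Sigma>.
          (\<forall>A. critical_point (penalized_loss S \<eta>) A \<longleftrightarrow> A = \<Sigma>)
        \<and> (\<forall>A. is_arg_min (penalized_loss S \<eta>) pos_def A \<longleftrightarrow> A = \<Sigma>))"
proof -
  let ?F = "penalized_loss S \<eta>"
  have psd: "\<And>v. 0 \<le> v \<bullet> (S *v v)"
    unfolding S_def by (rule sample_cov_psd)
  have sym: "transpose S = S"
    unfolding S_def by (rule transpose_sample_cov)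
  have strict: "pos_def S \<or> \<eta> > 0"
    using eta_pos sample_cov_pos_def unfolding S_def by blast
  have convex: "strictly_g_convex ?F"
    by (rule penalized_loss_strictly_g_convex[OF psd eta_nonneg strict])
  obtain K where K: "\<And>A. pos_def A \<Longrightarrow> norm (mat_log A) - K \<le> ?F A"
    using penalized_loss_lower_bound[OF psd eta_nonneg strict] by blast
  have coercive: "g_coercive ?F"
    unfolding g_coercive_iff
  proof (intro allI)
    fix M
    show "\<exists>R. \<forall>A. pos_def A \<and> R \<le> norm (mat_log A) \<longrightarrow> M \<le> ?F A"
    proof (intro exI[of _ "M + K"] allI impI)
      fix A :: "real^'q^'q"
      assume "pos_def A \<and> M + K \<le> norm (mat_log A)"
      then show "M \<le> ?F A"
        using K[of A] by linarith
    qed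
  qed
  obtain \<Sigma> where \<Sigma>: "pos_def \<Sigma>" and min: "\<And>B. pos_def B \<Longrightarrow> ?F \<Sigma> \<le> ?F B"
    using penalized_loss_attains_min[OF K] by blast
  have unique: "A = \<Sigma>" if "pos_def A" "?F A \<le> ?F \<Sigma>" for A
    using strictly_g_convex_unique_minimum[OF convex \<Sigma> that(1) min that(2)] by simp
  obtain G C \<delta> where "transpose G = G" "C \<ge> 0" "\<delta> > 0"
    "\<And>B. pos_def B \<Longrightarrow> norm (B - \<Sigma>) < \<delta> \<Longrightarrow> ?F B \<le> ?F \<Sigma> + G \<bullet> (B - \<Sigma>) + C * (norm (B - \<Sigma>))\<^sup>2"
    by (rule penalized_loss_upper_expansion[OF sym eta_nonneg \<Sigma>]) (rule that)
  then have "critical_point ?F \<Sigma>"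
    by (intro minimum_imp_critical_point[of \<Sigma> ?F G C \<delta>] \<Sigma> min)
  moreover have "A = \<Sigma>" if "critical_point ?F A" for A
    using that critical_point_imp_minimum[OF convex that \<Sigma>] unique
    by (auto simp: critical_point_def)
  moreover have "is_arg_min ?F pos_def A \<longleftrightarrow> A = \<Sigma>" for A
    unfolding is_arg_min_linorder using \<Sigma> min unique by blast
  ultimately show ?thesis
    using convex coercive by blast
qed

end
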